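(* Let $\gamma>0$, $\varphi_0(r)=\left(1+\log\frac{1}{1-r}\right)^{-\gamma}$, $r\in[0,1)$, let $L\ge1$ be an integer, $I_j=[2\pi(j-1)/L,2\pi j/L)$, and $\tilde\chi_j(re^{i\theta})=\mathbf{1}_{I_j}(\theta)\varphi_0(r)$ for $j=1,\dots,L$. Then for all $j\neq k$, $j,k\in\{1,\dots,L\}$, $$T_{\tilde\chi_k}^*T_{\tilde\chi_j}\in\Sigma^0_{2\gamma}\quad\text{and}\quad T_{\tilde\chi_k}T_{\tilde\chi_j}^*\in\Sigma^0_{2\gamma}.$$
   Context: $L^2_a(\mathbb{D})$ is the Bergman space (analytic functions in $L^2(\mathbb{D},dx\,dy/\pi)$), $P_+$ the orthogonal projection onto it, and $T_\varphi f=P_+(\varphi f)$ the Toeplitz operator with bounded symbol $\varphi$. For $\beta>0$, $\Sigma^0_\beta$ is the class of compact operators $A$ whose singular values satisfy $s_n(A)=o\big((\log(n+1))^{-\beta}\big)$ as $n\to\infty$. *)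

theory Defs
  imports "HOL-Analysis.Analysis" "HOL-Library.Landau_Symbols"
begin

text \<open>Functions on the unit disc are represented as complex \<Rightarrow> complex; the normalised
area measure is dx dy / pi.\<close>

definition disc :: "complex set" where "disc = ball 0 1"

definition L2D :: "(complex \<Rightarrow> complex) set" where
  "L2D = {f. f \<in> borel_measurable lborel \<and>
            (\<integral>\<^sup>+ z. ennreal (indicator disc z * (cmod (f z))\<^sup>2) \<partial>lborel) < \<infinity>}"

definition l2_inner :: "(complex \<Rightarrow> complex) \<Rightarrow> (complex \<Rightarrow> complex) \<Rightarrow> complex" where
  "l2_inner f g = (LINT z|lborel. indicator disc z * f z * cnj (g z)) / of_real pi"

definition l2_norm :: "(complex \<Rightarrow> complex) \<Rightarrow> real" where
  "l2_norm f = sqrt ((LINT z|lborel. indicator disc z * (cmod (f z))\<^sup>2) / pi)"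

text \<open>Bergman space; elements are normalised to vanish outside the open disc so that
each element of L^2_a has a unique representative.\<close>
definition bergman :: "(complex \<Rightarrow> complex) set" where
  "bergman = {f. f \<in> L2D \<and> f holomorphic_on disc \<and> (\<forall>z. z \<notin> disc \<longrightarrow> f z = 0)}"

definition bergman_proj :: "(complex \<Rightarrow> complex) \<Rightarrow> (complex \<Rightarrow> complex)" where
  "bergman_proj g = (THE f. f \<in> bergman \<and> (\<forall>h\<in>bergman. l2_inner (\<lambda>z. g z - f z) h = 0))"

definition toeplitz :: "(complex \<Rightarrow> complex) \<Rightarrow> (complex \<Rightarrow> complex) \<Rightarrow> (complex \<Rightarrow> complex)" where
  "toeplitz \<phi> f = bergman_proj (\<lambda>z. \<phi> z * f z)"

definition adjoint_op ::
  "((complex \<Rightarrow> complex) \<Rightarrow> (complex \<Rightarrow> complex)) \<Rightarrow> (complex \<Rightarrow> complex) \<Rightarrow> (complex \<Rightarrow> complex)" where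
  "adjoint_op A g = (THE h. h \<in> bergman \<and> (\<forall>f\<in>bergman. l2_inner (A f) g = l2_inner f h))"

definition linear_on_bergman :: "((complex \<Rightarrow> complex) \<Rightarrow> (complex \<Rightarrow> complex)) \<Rightarrow> bool" where
  "linear_on_bergman A \<longleftrightarrow> (\<forall>f\<in>bergman. A f \<in> bergman) \<and>
     (\<forall>f\<in>bergman. \<forall>g\<in>bergman. \<forall>a b. A (\<lambda>z. a * f z + b * g z) = (\<lambda>z. a * A f z + b * A g z))"

definition bounded_on_bergman :: "((complex \<Rightarrow> complex) \<Rightarrow> (complex \<Rightarrow> complex)) \<Rightarrow> bool" where
  "bounded_on_bergman A \<longleftrightarrow> (\<exists>C. \<forall>f\<in>bergman. l2_norm (A f) \<le> C * l2_norm f)"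

definition op_norm :: "((complex \<Rightarrow> complex) \<Rightarrow> (complex \<Rightarrow> complex)) \<Rightarrow> real" where
  "op_norm A = Sup {l2_norm (A f) | f. f \<in> bergman \<and> l2_norm f \<le> 1}"

definition rank_le :: "nat \<Rightarrow> ((complex \<Rightarrow> complex) \<Rightarrow> (complex \<Rightarrow> complex)) \<Rightarrow> bool" where
  "rank_le n K \<longleftrightarrow> (\<exists>e :: nat \<Rightarrow> complex \<Rightarrow> complex.
      \<forall>f\<in>bergman. \<exists>c :: nat \<Rightarrow> complex. K f = (\<lambda>z. \<Sum>i<n. c i * e i z))"

definition sing_val :: "nat \<Rightarrow> ((complex \<Rightarrow> complex) \<Rightarrow> (complex \<Rightarrow> complex)) \<Rightarrow> real" where
  "sing_val n A = Inf {op_norm (\<lambda>f z. A f z - K f z) | K.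
       linear_on_bergman K \<and> bounded_on_bergman K \<and> rank_le n K}"

definition compact_op :: "((complex \<Rightarrow> complex) \<Rightarrow> (complex \<Rightarrow> complex)) \<Rightarrow> bool" where
  "compact_op A \<longleftrightarrow> linear_on_bergman A \<and>
     (\<forall>u :: nat \<Rightarrow> complex \<Rightarrow> complex. (\<forall>n. u n \<in> bergman) \<and> (\<exists>M. \<forall>n. l2_norm (u n) \<le> M) \<longrightarrow>
        (\<exists>r :: nat \<Rightarrow> nat. strict_mono r \<and> (\<forall>\<epsilon>>0. \<exists>N. \<forall>m\<ge>N. \<forall>n\<ge>N.
            l2_norm (\<lambda>z. A (u (r m)) z - A (u (r n)) z) < \<epsilon>)))"

definition Sigma0 :: "real \<Rightarrow> ((complex \<Rightarrow> complex) \<Rightarrow> (complex \<Rightarrow> complex)) \<Rightarrow> bool" where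
  "Sigma0 \<beta> A \<longleftrightarrow> compact_op A \<and>
     (\<lambda>n. sing_val n A) \<in> o(\<lambda>n. (ln (real n + 1)) powr (- \<beta>))"

definition phi0 :: "real \<Rightarrow> real \<Rightarrow> real" where
  "phi0 \<gamma> r = (1 + ln (1 / (1 - r))) powr (- \<gamma>)"

definition angle0 :: "complex \<Rightarrow> real" where
  "angle0 z = (if Arg z < 0 then Arg z + 2 * pi else Arg z)"

definition chi_tilde :: "real \<Rightarrow> nat \<Rightarrow> nat \<Rightarrow> complex \<Rightarrow> complex" where
  "chi_tilde \<gamma> L j z = (if z \<in> disc \<and> angle0 z \<in> {2 * pi * (real j - 1) / real L ..< 2 * pi * real j / real L}
      then complex_of_real (phi0 \<gamma> (cmod z)) else 0)"

end

theory Submission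
  imports Defs "HOL-Complex_Analysis.Complex_Analysis"
begin

text \<open>
  Write the product as \<open>P \<chi>\<^sub>k P \<chi>\<^sub>j P\<close>. The kernel \<open>1 / (1 - z w*)\<^sup>2\<close> (with \<open>w*\<close> the conjugate of \<open>w\<close>)
  of the Bergman projection is singular for \<open>z\<close> and \<open>w\<close> in different sectors only near a common
  corner on the unit circle: if \<open>d(w)\<close> is the distance from \<open>w\<close> to the two corners of its sector,
  then \<open>|1 - z w*| \<ge> d(w) / 3\<close>. Split \<open>\<chi>\<^sub>j\<close> at \<open>d(w) = 2\<^sup>-\<^sup>n\<close>. The part near the corners
  is at most \<open>\<phi>\<^sub>0(1 - 2\<^sup>-\<^sup>n)\<close>, which is of order \<open>n\<^sup>-\<^sup>\<gamma>\<close>. The remaining region is covered by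
  \<open>O(n)\<close> Whitney-type discs, and a Taylor polynomial of degree \<open>4 n\<close> in the conjugate of \<open>w\<close> on
  each of them gives an operator of rank \<open>O(n\<^sup>2)\<close> that is exponentially close. Hence the singular
  values satisfy \<open>s\<^sub>N = O(N powr (- \<gamma> / 2))\<close>, far below any power of the logarithm.
  Since the symbols are real, the Toeplitz operators are self-adjoint.
\<close>

section \<open>Normalised area measure on the disc\<close>

unbundle no fps_syntax

text \<open>The symbol decays only logarithmically at the circle. Cutting it where 1 - |w| = 2^-n
  would leave a region of about 2^n Whitney cells, and a remainder of order n^-gamma against such a
  rank gives no more than a logarithmic rate. The angular separation of the sectors is what allows
  cutting around two points only: away from the corners the region may touch the circle, since the
  kernel stays smooth there. Nothing is lost near the corners, because d(w) is at least 1 - |w|, so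
  a small d(w) forces a small symbol. Uniform estimates of the kernel are enough:
  \<open>area\<close> is a probability measure, so sup norms dominate L2 norms and L2 norms dominate
  L1 norms, and the projection is a contraction. \<open>bergman_proj\<close> and
  \<open>adjoint_op\<close> are definite descriptions, so their existence and uniqueness have to be
  proved. The integral operator \<open>bergman_integral\<close> is built from power series,
  identified with the projection, and used in all computations afterwards.\<close>

definition area :: "complex measure" where
  "area = density lborel (\<lambda>z. ennreal (indicator disc z / pi))"

lemma sets_area [measurable_cong, simp]: "sets area = sets borel"
  and space_area [simp]: "space area = UNIV"
  by (simp_all add: area_def)

lemma disc_borel [measurable]: "disc \<in> sets borel"
  by (simp add: disc_def)

lemma emeasure_area:
  assumes [measurable]: "A \<in> sets borel"
  shows "emeasure area A = emeasure lborel (A \<inter> disc) / ennreal pi"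
proof -
  have "emeasure area A = (\<integral>\<^sup>+z. ennreal (1/pi) * indicator (A \<inter> disc) z \<partial>lborel)"
    by (simp add: area_def emeasure_density)
      (intro nn_integral_cong, auto simp: indicator_def)
  also have "\<dots> = emeasure lborel (A \<inter> disc) / ennreal pi"
    by (subst nn_integral_cmult_indicator)
       (auto simp: divide_ennreal_def inverse_ennreal mult.commute divide_inverse)
  finally show ?thesis .
qed

lemma emeasure_area_ball:
  assumes "0 \<le> r" "r \<le> 1"
  shows "emeasure area (ball 0 r) = ennreal (r\<^sup>2)"
proof -
  have "ball 0 r \<inter> disc = ball (0::complex) r"
    using assms by (auto simp: disc_def)
  moreover have "emeasure lborel (ball (0::complex) r) = ennreal (pi * r\<^sup>2)"
    using emeasure_ball[of r "0::complex"] assms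
    by (simp add: eval_unit_ball_vol)
  ultimately show ?thesis
    by (simp add: emeasure_area divide_ennreal)
qed

text \<open>Rotation invariance is transferred from \<open>real^2\<close>, the only type for which the library has it.\<close>

lemma measurable_Complex_vec [measurable]:
  "(\<lambda>v::real^2. Complex (v $ 1) (v $ 2)) \<in> borel_measurable borel"
  unfolding Complex_eq
  by (intro borel_measurable_continuous_onI continuous_intros)

lemma prod_Basis_vec2: "(\<Prod>b\<in>Basis. (x::real^2) \<bullet> b) = x $ 1 * x $ 2"
proof -
  have "(\<Prod>b\<in>Basis. x \<bullet> b) = (\<Prod>i\<in>UNIV. x \<bullet> axis i 1)"
    by (rule prod.reindex_cong[of "\<lambda>i. axis i 1"])
       (auto simp: inj_on_def axis_eq_axis Basis_vec_def)
  thus ?thesis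
    by (simp add: inner_axis UNIV_2)
qed

lemma in_Basis_vec2: "b \<in> (Basis :: (real^2) set) \<Longrightarrow> b = axis 1 1 \<or> b = axis 2 1"
  by (auto simp: Basis_vec_def) (metis exhaust_2)

lemma distr_lborel_Complex_vec:
  "distr lborel borel (\<lambda>v::real^2. Complex (v $ 1) (v $ 2)) = lborel"
proof (rule lborel_eqI[symmetric], goal_cases)
  case (1 l u)
  have lu: "Re l \<le> Re u" "Im l \<le> Im u"
    using 1[of 1] 1[of \<i>] by (auto simp: Basis_complex_def)
  let ?l = "vector [Re l, Im l] :: real^2" and ?u = "vector [Re u, Im u] :: real^2"
  have "(\<lambda>v::real^2. Complex (v $ 1) (v $ 2)) -` box l u = box ?l ?u"
    by (auto simp: mem_box_cart in_box_complex_iff forall_2)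
  moreover have "emeasure lborel (box ?l ?u) = ennreal ((Re u - Re l) * (Im u - Im l))"
    by (subst emeasure_lborel_box)
       (use lu in \<open>auto simp: prod_Basis_vec2 cart_eq_inner_axis[symmetric] inner_axis axis_in_Basis_iff dest!: in_Basis_vec2\<close>)
  ultimately show ?case
    using lu by (simp add: emeasure_distr Basis_complex_def)
qed auto

lemma distr_lborel_rotation:
  assumes c: "cmod c = 1"
  shows "distr lborel borel ((*) c) = lborel"
proof (rule lborel_eqI[symmetric], goal_cases)
  case (1 l u)
  have [measurable]: "(*) c \<in> borel_measurable borel" by simp
  let ?f = "\<lambda>v::real^2. Complex (v $ 1) (v $ 2)"
  define g :: "complex \<Rightarrow> real^2" where "g z = vector [Re z, Im z]" for z
  \<comment> \<open>As |c| = 1, \<open>R\<close> is multiplication by the inverse of c in real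
    coordinates. The preimage of a box under rotation by c is therefore the image of that box under
    the orthogonal map \<open>R\<close>.\<close>
  define R where "R v = g (cnj c * ?f v)" for v
  have fg: "?f (g z) = z" and gf: "g (?f v) = v" for z v
    by (simp_all add: g_def vec_eq_iff forall_2)
  have ccnj: "c * cnj c = 1"
    using c by (simp add: complex_norm_square[symmetric])
  have "linear R"
    by (rule linearI) (auto simp: R_def g_def vec_eq_iff forall_2 algebra_simps)
  moreover have "norm (R v) = norm v" for v
  proof -
    have "norm (g z) = cmod z" for z
      by (simp add: g_def norm_vec_def L2_set_def cmod_def UNIV_2)
    hence "norm (R v) = cmod (cnj c * ?f v)" by (simp only: R_def)
    also have "\<dots> = norm (g (?f v))"
      using c \<open>\<And>z. norm (g z) = cmod z\<close> by (simp only: norm_mult complex_mod_cnj mult_1)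
    finally show ?thesis by (simp only: gf)
  qed
  ultimately have R: "orthogonal_transformation R"
    by (simp add: orthogonal_transformation)
  define S where "S = ?f -` box l u"
  have S_eq: "S = box (g l) (g u)"
    by (auto simp: S_def g_def mem_box_cart in_box_complex_iff forall_2)
  hence S: "S \<in> lmeasurable" by simp
  have eq: "?f -` ((*) c -` box l u) = R ` S"
  proof (intro equalityI subsetI)
    fix v assume v: "v \<in> ?f -` ((*) c -` box l u)"
    have "R (g (c * ?f v)) = v"
      using ccnj by (simp only: R_def fg mult.assoc[symmetric] mult.commute[of "cnj c"] mult_1 gf)
    moreover have "g (c * ?f v) \<in> S"
      using v by (simp only: S_def vimage_eq fg)
    ultimately show "v \<in> R ` S" by (metis image_eqI)
  next
    fix v assume "v \<in> R ` S"
    then obtain s where s: "s \<in> S" "v = R s" by auto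
    have "c * ?f v = ?f s"
      using ccnj by (simp only: s R_def fg mult.assoc[symmetric] mult_1)
    thus "v \<in> ?f -` ((*) c -` box l u)"
      using s by (simp only: S_def vimage_eq)
  qed
  have B: "(*) c -` box l u \<in> sets borel"
    by (rule measurable_sets_borel[of "(*) c" borel]) auto
  have RS: "R ` S \<in> sets borel"
    unfolding eq[symmetric] using B by (rule measurable_sets_borel[OF measurable_Complex_vec])
  have "emeasure (distr lborel borel ((*) c)) (box l u) = emeasure lborel ((*) c -` box l u)"
    by (simp add: emeasure_distr)
  also have "\<dots> = emeasure (distr lborel borel ?f) ((*) c -` box l u)"
    by (simp only: distr_lborel_Complex_vec)
  also have "\<dots> = emeasure lborel (?f -` ((*) c -` box l u))"
    by (subst emeasure_distr) (use B in auto)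
  also have "\<dots> = emeasure lebesgue (R ` S)"
    unfolding eq using RS by simp
  also have "\<dots> = emeasure lebesgue S"
    using measure_orthogonal_image[OF R S] measurable_orthogonal_image[OF R S] S
    by (simp add: emeasure_eq_measure2)
  also have "\<dots> = emeasure lborel S" by (simp add: S_eq)
  also have "\<dots> = emeasure (distr lborel borel ?f) (box l u)"
    by (simp add: emeasure_distr S_def)
  also have "\<dots> = emeasure lborel (box l u)"
    by (simp only: distr_lborel_Complex_vec)
  finally show ?case using 1 by simp
qed auto


lemma distr_area_rotation:
  assumes c: "cmod c = 1"
  shows "distr area area ((*) c) = area"
proof (rule measure_eqI)
  fix A assume "A \<in> sets (distr area area ((*) c))"
  hence A [measurable]: "A \<in> sets borel" by simp
  have [measurable]: "(*) c -` A \<in> sets borel"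
    by (rule measurable_sets_borel[of "(*) c" borel]) auto
  have "(*) c -` A \<inter> disc = (*) c -` (A \<inter> disc)"
    using c by (auto simp: disc_def norm_mult)
  moreover have "emeasure lborel ((*) c -` (A \<inter> disc)) = emeasure (distr lborel borel ((*) c)) (A \<inter> disc)"
    by (simp add: emeasure_distr)
  ultimately show "emeasure (distr area area ((*) c)) A = emeasure area A"
    using c by (simp add: emeasure_distr emeasure_area distr_lborel_rotation)
qed simp

lemma prob_space_area: "emeasure area UNIV = 1"
proof -
  have "emeasure area UNIV = emeasure area (ball 0 1)"
    by (simp add: emeasure_area disc_def)
  thus ?thesis by (simp add: emeasure_area_ball)
qed

interpretation area: finite_measure area
  by standard (simp add: prob_space_area)

lemma AE_area_disc: "AE z in area. z \<in> disc"
  unfolding area_def by (subst AE_density) (auto simp: indicator_def)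

lemma integral_area_rotation:
  fixes f :: "complex \<Rightarrow> 'a :: {banach, second_countable_topology}"
  assumes "f \<in> borel_measurable borel" "cmod c = 1"
  shows "(LINT z|area. f (c * z)) = (LINT z|area. f z)"
proof -
  have "(LINT z|area. f z) = (LINT z|distr area area ((*) c). f z)"
    using assms by (simp add: distr_area_rotation)
  also have "\<dots> = (LINT z|area. f (c * z))"
    using assms by (subst integral_distr) auto
  finally show ?thesis ..
qed

text \<open>A centred disc of radius r <= 1 has mass r^2, so the squared modulus is uniformly
  distributed on [0,1]. Both measures are compared on half-lines; the moments of |z| become
  integrals of t^n.\<close>

lemma distr_area_norm_square:
  "distr area borel (\<lambda>z. (cmod z)\<^sup>2) = density lborel (indicator {0..1})"
proof (rule measure_eqI_lessThan, goal_cases)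
  case (3 x)
  show ?case
    by (simp add: emeasure_distr less_top[symmetric] area.emeasure_finite)
next
  case (4 x)
  have "emeasure (distr area borel (\<lambda>z. (cmod z)\<^sup>2)) {x<..} = emeasure area (UNIV - {z. (cmod z)\<^sup>2 \<le> x})"
    by (simp add: emeasure_distr) (rule arg_cong[where f="emeasure area"], auto)
  also have "\<dots> = 1 - emeasure area {z. (cmod z)\<^sup>2 \<le> x}"
    by (subst emeasure_Diff) (auto simp: prob_space_area area.emeasure_finite)
  also have "emeasure area {z. (cmod z)\<^sup>2 \<le> x} = ennreal (max 0 (min 1 x))"
  proof (cases "x < 0")
    case True
    hence "{z::complex. (cmod z)\<^sup>2 \<le> x} = {}"
      by (auto simp: not_le intro: less_le_trans)
    thus ?thesis using True by simp
  next
    case False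
    have "{z::complex. (cmod z)\<^sup>2 \<le> x} = cball 0 (sqrt x)"
      using False by (auto simp: real_le_rsqrt real_sqrt_le_iff sqrt_le_D intro: real_le_rsqrt)
        (metis norm_ge_zero not_less real_sqrt_pow2 power_mono)
    hence "emeasure area {z. (cmod z)\<^sup>2 \<le> x} = emeasure area (cball 0 (sqrt x))" by simp
    \<comment> \<open>The circle and the outside of the unit disc are null sets, so the closed disc
      may be replaced by an open one of radius at most 1, whose mass is known.\<close>
    also have "\<dots> = emeasure area (ball 0 (sqrt (min 1 x)))"
    proof (rule emeasure_eq_AE)
      have "AE z in lborel. z \<notin> sphere (0::complex) (sqrt x)"
        using negligible_sphere[of "0::complex" "sqrt x"]
        by (intro AE_not_in) (auto simp: null_sets_completion_iff negligible_iff_null_sets)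
      hence "AE z in area. z \<notin> sphere 0 (sqrt x)"
        unfolding area_def by (subst AE_density) auto
      with AE_area_disc show "AE z in area. z \<in> cball 0 (sqrt x) \<longleftrightarrow> z \<in> ball 0 (sqrt (min 1 x))"
      proof eventually_elim
        case (elim z)
        show ?case
        proof (cases "1 \<le> x")
          case True
          hence "1 \<le> sqrt x" by simp
          moreover have "cmod z < 1" using elim by (simp add: disc_def)
          ultimately have "cmod z < sqrt x" by linarith
          thus ?thesis using True \<open>cmod z < 1\<close> by simp
        next
          case False
          thus ?thesis using elim by (simp add: min_def less_le)
        qed
      qed
    qed auto
    also have "\<dots> = ennreal (min 1 x)"
      using False by (subst emeasure_area_ball) auto
    finally show ?thesis using False by simp
  qed
  also have "1 - ennreal (max 0 (min 1 x)) = ennreal (1 - max 0 (min 1 x))"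
    by (simp add: ennreal_minus flip: ennreal_1)
  also have "\<dots> = emeasure lborel ({0..1} \<inter> {x<..})"
  proof -
    have "emeasure lborel ({0..1} \<inter> {x<..}) = emeasure lborel {max 0 (min 1 x)<..1}"
    proof (rule emeasure_eq_AE)
      have "AE z in lborel. z \<noteq> 0" by (rule AE_lborel_singleton)
      thus "AE z in lborel. z \<in> {0..1} \<inter> {x<..} \<longleftrightarrow> z \<in> {max 0 (min 1 x)<..1}"
        by eventually_elim auto
    qed auto
    thus ?thesis by simp
  qed
  also have "\<dots> = emeasure (density lborel (indicator {0..1})) {x<..}"
    by (simp add: emeasure_density indicator_inter_arith[symmetric])
  finally show ?case .
qed auto

lemma integral_area_norm_power:
  "(LINT z|area. (cmod z) ^ (2 * n)) = 1 / (real n + 1)"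
proof -
  have "(LINT z|area. (cmod z) ^ (2 * n)) = (LINT t|distr area borel (\<lambda>z. (cmod z)\<^sup>2). t ^ n)"
    by (subst integral_distr) (auto simp: power_mult)
  also have "\<dots> = (LINT t|density lborel (\<lambda>t. ennreal (indicator {0..1} t)). t ^ n)"
    by (simp add: distr_area_norm_square ennreal_indicator[abs_def])
  also have "\<dots> = (LINT t|lborel. indicator {0..1} t *\<^sub>R (t ^ n))"
    by (subst integral_density) auto
  also have "\<dots> = 1 / (real n + 1)"
    using integral_power[of 0 1 n] by (simp add: mult.commute add.commute)
  finally show ?thesis .
qed

lemma measurable_cnj [measurable]: "cnj \<in> borel_measurable borel"
  by (intro borel_measurable_continuous_onI continuous_intros)

text \<open>Rotating by \<open>pi / (m - n)\<close> changes the sign of the integrand.\<close>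

lemma integral_area_radial_monomials:
  fixes g :: "real \<Rightarrow> real"
  assumes [measurable]: "g \<in> borel_measurable borel" and mn: "m \<noteq> n"
  shows "(LINT z|area. of_real (g (cmod z)) * (z ^ m * cnj (z ^ n))) = 0" (is "?I = 0")
proof -
  define t where "t = pi / (real m - real n)"
  define c where "c = cis t"
  have c1: "cmod c = 1" by (simp add: c_def)
  have "c ^ m * cnj c ^ n = cis ((real m - real n) * t)"
    by (simp add: c_def Complex.DeMoivre cis_cnj cis_mult) (simp add: algebra_simps)
  also have "(real m - real n) * t = pi" using mn by (simp add: t_def)
  finally have c2: "c ^ m * cnj c ^ n = -1" by simp
  have "?I = (LINT z|area. of_real (g (cmod (c * z))) * ((c * z) ^ m * cnj ((c * z) ^ n)))"
    by (rule integral_area_rotation[symmetric]) (use c1 in auto)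
  also have "\<dots> = (LINT z|area. (c ^ m * cnj c ^ n) * (of_real (g (cmod z)) * (z ^ m * cnj (z ^ n))))"
    using c1 by (simp add: norm_mult power_mult_distrib mult_ac)
  also have "\<dots> = - ?I" by (simp add: c2)
  finally show ?thesis by simp
qed

section \<open>The space L2 of the disc\<close>

lemma integral_area:
  fixes f :: "complex \<Rightarrow> 'a :: {banach, second_countable_topology}"
  assumes [measurable]: "f \<in> borel_measurable borel"
  shows "(LINT z|area. f z) = (LINT z|lborel. indicator disc z *\<^sub>R f z) /\<^sub>R pi"
proof -
  have "(LINT z|area. f z) = (LINT z|lborel. (indicator disc z / pi) *\<^sub>R f z)"
    unfolding area_def by (subst integral_density) auto
  also have "\<dots> = (LINT z|lborel. (1 / pi) *\<^sub>R (indicator disc z *\<^sub>R f z))"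
    by simp
  also have "\<dots> = (LINT z|lborel. indicator disc z *\<^sub>R f z) /\<^sub>R pi"
    by (subst integral_scaleR_right) (simp add: divide_inverse)
  finally show ?thesis .
qed

lemma L2D_iff:
  "f \<in> L2D \<longleftrightarrow> f \<in> borel_measurable borel \<and> integrable area (\<lambda>z. (cmod (f z))\<^sup>2)"
proof (cases "f \<in> borel_measurable borel")
  case True
  hence [measurable]: "f \<in> borel_measurable borel" .
  have "(\<integral>\<^sup>+z. ennreal ((cmod (f z))\<^sup>2) \<partial>area) =
      (\<integral>\<^sup>+z. ennreal (1/pi) * ennreal (indicator disc z * (cmod (f z))\<^sup>2) \<partial>lborel)"
    unfolding area_def
    by (subst nn_integral_density) (auto intro!: nn_integral_cong simp: ennreal_mult'[symmetric])
  also have "\<dots> = ennreal (1/pi) * (\<integral>\<^sup>+z. ennreal (indicator disc z * (cmod (f z))\<^sup>2) \<partial>lborel)"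
    by (subst nn_integral_cmult) auto
  finally show ?thesis using True
    by (auto simp: L2D_def integrable_iff_bounded ennreal_mult_less_top less_top[symmetric] ennreal_mult_eq_top_iff)
qed (auto simp: L2D_def)

lemma L2D_measurable [measurable_dest]: "f \<in> L2D \<Longrightarrow> f \<in> borel_measurable borel"
  by (simp add: L2D_iff)

lemma l2_inner_eq:
  assumes [measurable]: "f \<in> borel_measurable borel" "g \<in> borel_measurable borel"
  shows "l2_inner f g = (LINT z|area. f z * cnj (g z))"
proof -
  have "(LINT z|lborel. indicator disc z *\<^sub>R (f z * cnj (g z))) = (LINT z|lborel. indicator disc z * f z * cnj (g z))"
    by (intro Bochner_Integration.integral_cong) (auto simp: indicator_def)
  thus ?thesis
    by (subst integral_area) (auto simp: l2_inner_def scaleR_conv_of_real divide_inverse)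
qed

lemma l2_norm_eq:
  assumes [measurable]: "f \<in> borel_measurable borel"
  shows "l2_norm f = sqrt (LINT z|area. (cmod (f z))\<^sup>2)"
  by (subst integral_area) (auto simp: l2_norm_def divide_inverse mult.commute)

lemma l2_norm_nonneg: "0 \<le> l2_norm f"
  unfolding l2_norm_def
  by (intro real_sqrt_ge_zero divide_nonneg_pos Bochner_Integration.integral_nonneg) auto

lemma l2_norm_square: "f \<in> L2D \<Longrightarrow> (l2_norm f)\<^sup>2 = (LINT z|area. (cmod (f z))\<^sup>2)"
  by (subst l2_norm_eq) auto

lemma L2D_integrable_norm_mult:
  assumes "f \<in> L2D" "g \<in> L2D"
  shows "integrable area (\<lambda>z. cmod (f z) * cmod (g z))"
proof (rule Bochner_Integration.integrable_bound)
  show "integrable area (\<lambda>z. (cmod (f z))\<^sup>2 + (cmod (g z))\<^sup>2)"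
    using assms by (auto simp: L2D_iff)
  show "AE z in area. norm (cmod (f z) * cmod (g z)) \<le> norm ((cmod (f z))\<^sup>2 + (cmod (g z))\<^sup>2)"
  proof (rule AE_I2)
    fix z
    have "2 * cmod (f z) * cmod (g z) \<le> (cmod (f z))\<^sup>2 + (cmod (g z))\<^sup>2"
      by (rule sum_squares_bound)
    moreover have "0 \<le> cmod (f z) * cmod (g z)" by simp
    ultimately have "cmod (f z) * cmod (g z) \<le> (cmod (f z))\<^sup>2 + (cmod (g z))\<^sup>2"
      by linarith
    thus "norm (cmod (f z) * cmod (g z)) \<le> norm ((cmod (f z))\<^sup>2 + (cmod (g z))\<^sup>2)"
      by (simp add: abs_mult)
  qed
qed (use assms in measurable)

lemma L2D_integrable_mult:
  assumes "f \<in> L2D" "g \<in> L2D"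
  shows "integrable area (\<lambda>z. f z * cnj (g z))"
  by (rule Bochner_Integration.integrable_bound[OF L2D_integrable_norm_mult[OF assms]])
     (use assms in \<open>auto simp: norm_mult\<close>)

lemma L2D_add:
  assumes "f \<in> L2D" "g \<in> L2D"
  shows "(\<lambda>z. f z + g z) \<in> L2D"
  unfolding L2D_iff
proof
  show "integrable area (\<lambda>z. (cmod (f z + g z))\<^sup>2)"
  proof (rule Bochner_Integration.integrable_bound)
    show "integrable area (\<lambda>z. 2 * (cmod (f z))\<^sup>2 + 2 * (cmod (g z))\<^sup>2)"
      using assms by (auto simp: L2D_iff)
    have "(cmod (f z + g z))\<^sup>2 \<le> 2 * (cmod (f z))\<^sup>2 + 2 * (cmod (g z))\<^sup>2" for z
    proof -
      have "(cmod (f z + g z))\<^sup>2 \<le> (cmod (f z) + cmod (g z))\<^sup>2"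
        by (intro power_mono norm_triangle_ineq) auto
      also have "\<dots> \<le> 2 * (cmod (f z))\<^sup>2 + 2 * (cmod (g z))\<^sup>2"
        using sum_squares_bound[of "cmod (f z)" "cmod (g z)"] by (simp add: power2_sum)
      finally show ?thesis .
    qed
    thus "AE z in area. norm ((cmod (f z + g z))\<^sup>2) \<le> norm (2 * (cmod (f z))\<^sup>2 + 2 * (cmod (g z))\<^sup>2)"
      by auto
  qed (use assms in measurable)
qed (use assms in measurable)

lemma L2D_mult_bounded:
  assumes "f \<in> L2D" "u \<in> borel_measurable borel" "\<And>z. z \<in> disc \<Longrightarrow> cmod (u z) \<le> B"
  shows "(\<lambda>z. u z * f z) \<in> L2D"
  unfolding L2D_iff
proof
  show "integrable area (\<lambda>z. (cmod (u z * f z))\<^sup>2)"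
  proof (rule Bochner_Integration.integrable_bound)
    show "integrable area (\<lambda>z. B\<^sup>2 * (cmod (f z))\<^sup>2)"
      using assms by (auto simp: L2D_iff)
    show "AE z in area. norm ((cmod (u z * f z))\<^sup>2) \<le> norm (B\<^sup>2 * (cmod (f z))\<^sup>2)"
      using AE_area_disc
      by eventually_elim (auto simp: norm_mult power_mult_distrib intro!: mult_right_mono power_mono assms)
  qed (use assms in measurable)
qed (use assms in measurable)

lemma L2D_one: "(\<lambda>z. 1) \<in> L2D"
  by (auto simp: L2D_iff)

lemma L2D_bounded:
  assumes "u \<in> borel_measurable borel" "\<And>z. z \<in> disc \<Longrightarrow> cmod (u z) \<le> B"
  shows "u \<in> L2D"
  using L2D_mult_bounded[OF L2D_one assms] by simp

lemma L2D_cmult: "f \<in> L2D \<Longrightarrow> (\<lambda>z. c * f z) \<in> L2D"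
  by (rule L2D_mult_bounded[where B="cmod c"]) auto

lemma L2D_zero: "(\<lambda>z. 0) \<in> L2D"
  by (rule L2D_bounded[where B=0]) auto

lemma L2D_diff: "f \<in> L2D \<Longrightarrow> g \<in> L2D \<Longrightarrow> (\<lambda>z. f z - g z) \<in> L2D"
  using L2D_add[OF _ L2D_cmult[of g "-1"], of f] by simp

lemma L2D_sum: "(\<And>i. i \<in> I \<Longrightarrow> f i \<in> L2D) \<Longrightarrow> (\<lambda>z. \<Sum>i\<in>I. f i z) \<in> L2D"
  by (induction I rule: infinite_finite_induct) (auto intro: L2D_zero L2D_add)

lemma L2D_power: "(\<lambda>z. z ^ n) \<in> L2D"
  by (rule L2D_bounded[where B=1]) (auto simp: disc_def norm_power power_le_one)

lemma Cauchy_Schwarz_l2_norm: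
  assumes "f \<in> L2D" "g \<in> L2D"
  shows "(LINT z|area. cmod (f z) * cmod (g z)) \<le> l2_norm f * l2_norm g"
proof -
  note [measurable] = assms[THEN L2D_measurable]
  let ?C = "LINT z|area. cmod (f z) * cmod (g z)"
  have C0: "0 \<le> ?C" by (intro Bochner_Integration.integral_nonneg) auto
  have "(\<integral>\<^sup>+z. ennreal (cmod (f z)) * ennreal (cmod (g z)) \<partial>area)\<^sup>2 \<le>
      (\<integral>\<^sup>+z. (ennreal (cmod (f z)))\<^sup>2 \<partial>area) * (\<integral>\<^sup>+z. (ennreal (cmod (g z)))\<^sup>2 \<partial>area)"
    by (rule Cauchy_Schwarz_nn_integral) auto
  also have "(\<integral>\<^sup>+z. ennreal (cmod (f z)) * ennreal (cmod (g z)) \<partial>area) = ennreal ?C"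
    by (subst nn_integral_eq_integral[symmetric])
       (auto simp: ennreal_mult L2D_integrable_norm_mult assms)
  also have "(\<integral>\<^sup>+z. (ennreal (cmod (f z)))\<^sup>2 \<partial>area) = ennreal ((l2_norm f)\<^sup>2)"
    using assms by (subst l2_norm_square, simp, subst nn_integral_eq_integral[symmetric])
       (auto simp: L2D_iff ennreal_power)
  also have "(\<integral>\<^sup>+z. (ennreal (cmod (g z)))\<^sup>2 \<partial>area) = ennreal ((l2_norm g)\<^sup>2)"
    using assms by (subst l2_norm_square, simp, subst nn_integral_eq_integral[symmetric])
       (auto simp: L2D_iff ennreal_power)
  finally have "ennreal (?C\<^sup>2) \<le> ennreal ((l2_norm f * l2_norm g)\<^sup>2)"
    using C0 by (simp add: ennreal_power ennreal_mult'[symmetric] power_mult_distrib)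
  hence "?C\<^sup>2 \<le> (l2_norm f * l2_norm g)\<^sup>2" by simp
  thus ?thesis
    by (rule power2_le_imp_le) (use assms in \<open>auto intro!: mult_nonneg_nonneg l2_norm_nonneg\<close>)
qed

lemma cmod_l2_inner_le:
  assumes "f \<in> L2D" "g \<in> L2D"
  shows "cmod (l2_inner f g) \<le> l2_norm f * l2_norm g"
proof -
  have "cmod (l2_inner f g) \<le> (LINT z|area. cmod (f z * cnj (g z)))"
    by (subst l2_inner_eq) (use assms in \<open>auto intro: integral_norm_bound\<close>)
  also have "\<dots> \<le> l2_norm f * l2_norm g"
    using Cauchy_Schwarz_l2_norm[OF assms] by (simp add: norm_mult)
  finally show ?thesis .
qed

text \<open>Cauchy-Schwarz against the constant 1, which has norm 1 because the total mass is
  1.\<close>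

lemma integral_norm_le_l2_norm:
  assumes "f \<in> L2D"
  shows "(LINT z|area. cmod (f z)) \<le> l2_norm f"
proof -
  have "l2_norm (\<lambda>z. 1) = 1"
    by (simp add: l2_norm_eq measure_def prob_space_area)
  thus ?thesis using Cauchy_Schwarz_l2_norm[OF assms L2D_one] by simp
qed

lemma L2D_integrable: "f \<in> L2D \<Longrightarrow> integrable area f"
  using L2D_integrable_mult[OF _ L2D_one] by simp

lemma l2_norm_triangle:
  assumes "f \<in> L2D" "g \<in> L2D"
  shows "l2_norm (\<lambda>z. f z + g z) \<le> l2_norm f + l2_norm g"
proof (rule power2_le_imp_le)
  have "(l2_norm (\<lambda>z. f z + g z))\<^sup>2 = (LINT z|area. (cmod (f z + g z))\<^sup>2)"
    by (intro l2_norm_square L2D_add assms)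
  also have "\<dots> \<le> (LINT z|area. (cmod (f z))\<^sup>2 + 2 * (cmod (f z) * cmod (g z)) + (cmod (g z))\<^sup>2)"
  proof (rule Bochner_Integration.integral_mono)
    show "integrable area (\<lambda>z. (cmod (f z + g z))\<^sup>2)"
      using L2D_add[OF assms] by (simp add: L2D_iff)
    fix z
    have "(cmod (f z + g z))\<^sup>2 \<le> (cmod (f z) + cmod (g z))\<^sup>2"
      by (intro power_mono norm_triangle_ineq) auto
    thus "(cmod (f z + g z))\<^sup>2 \<le> (cmod (f z))\<^sup>2 + 2 * (cmod (f z) * cmod (g z)) + (cmod (g z))\<^sup>2"
      by (simp add: power2_sum)
  qed (use assms L2D_integrable_norm_mult[OF assms] in \<open>auto simp: L2D_iff\<close>)
  also have "\<dots> = (l2_norm f)\<^sup>2 + 2 * (LINT z|area. cmod (f z) * cmod (g z)) + (l2_norm g)\<^sup>2"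
    using assms L2D_integrable_norm_mult[OF assms] by (simp add: l2_norm_square) (simp add: L2D_iff)
  also have "\<dots> \<le> (l2_norm f)\<^sup>2 + 2 * (l2_norm f * l2_norm g) + (l2_norm g)\<^sup>2"
    using Cauchy_Schwarz_l2_norm[OF assms] by simp
  also have "\<dots> = (l2_norm f + l2_norm g)\<^sup>2" by (simp add: power2_sum)
  finally show "(l2_norm (\<lambda>z. f z + g z))\<^sup>2 \<le> (l2_norm f + l2_norm g)\<^sup>2" .
qed (use assms in \<open>auto intro!: add_nonneg_nonneg l2_norm_nonneg\<close>)

lemma l2_norm_mono:
  assumes "f \<in> L2D" "g \<in> L2D" "\<And>z. z \<in> disc \<Longrightarrow> cmod (f z) \<le> cmod (g z)"
  shows "l2_norm f \<le> l2_norm g"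
proof (rule power2_le_imp_le)
  show "(l2_norm f)\<^sup>2 \<le> (l2_norm g)\<^sup>2"
    unfolding l2_norm_square[OF assms(1)] l2_norm_square[OF assms(2)]
  proof (rule integral_mono_AE)
    show "AE z in area. (cmod (f z))\<^sup>2 \<le> (cmod (g z))\<^sup>2"
      using AE_area_disc by eventually_elim (auto intro!: power_mono assms)
  qed (use assms in \<open>auto simp: L2D_iff\<close>)
qed (use assms in \<open>auto intro: l2_norm_nonneg\<close>)

lemma l2_norm_cmult: "f \<in> L2D \<Longrightarrow> l2_norm (\<lambda>z. c * f z) = cmod c * l2_norm f"
  by (simp add: l2_norm_eq norm_mult power_mult_distrib real_sqrt_mult L2D_measurable)

lemma l2_norm_const: "l2_norm (\<lambda>z. c) = cmod c"
  by (simp add: l2_norm_eq measure_def prob_space_area)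

lemma l2_norm_le_const:
  assumes "f \<in> borel_measurable borel" "\<And>z. z \<in> disc \<Longrightarrow> cmod (f z) \<le> B"
  shows "l2_norm f \<le> B"
proof -
  have "0 \<le> B" using order.trans[OF norm_ge_zero assms(2)[of 0]] by (simp add: disc_def)
  have "l2_norm f \<le> l2_norm (\<lambda>z. of_real B)"
    using assms \<open>0 \<le> B\<close> by (intro l2_norm_mono L2D_bounded[OF assms]) (auto intro!: L2D_bounded[where B=B])
  thus ?thesis using \<open>0 \<le> B\<close> by (simp add: l2_norm_const)
qed

lemma l2_norm_mult_le:
  assumes "f \<in> L2D" "u \<in> borel_measurable borel" "\<And>z. z \<in> disc \<Longrightarrow> cmod (u z) \<le> B"
  shows "l2_norm (\<lambda>z. u z * f z) \<le> B * l2_norm f"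
proof -
  have "0 \<le> B" using order.trans[OF norm_ge_zero assms(3)[of 0]] by (simp add: disc_def)
  have "l2_norm (\<lambda>z. u z * f z) \<le> l2_norm (\<lambda>z. of_real B * f z)"
    using \<open>0 \<le> B\<close>
    by (intro l2_norm_mono L2D_mult_bounded[OF assms] L2D_cmult assms)
       (auto simp: norm_mult intro!: mult_right_mono assms)
  thus ?thesis using \<open>0 \<le> B\<close> assms by (simp add: l2_norm_cmult)
qed

lemma l2_norm_zero: "l2_norm (\<lambda>z. 0) = 0"
  by (simp add: l2_norm_eq)

lemma l2_inner_add_left:
  assumes "f \<in> L2D" "g \<in> L2D" "h \<in> L2D"
  shows "l2_inner (\<lambda>z. f z + g z) h = l2_inner f h + l2_inner g h"
proof -
  note [measurable] = assms[THEN L2D_measurable]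
  show ?thesis
    using assms by (simp add: l2_inner_eq distrib_right L2D_integrable_mult)
qed

lemma l2_inner_cmult_left:
  assumes "f \<in> L2D" "h \<in> L2D"
  shows "l2_inner (\<lambda>z. c * f z) h = c * l2_inner f h"
proof -
  note [measurable] = assms[THEN L2D_measurable]
  show ?thesis
    using assms by (simp add: l2_inner_eq mult.assoc)
qed

lemma l2_inner_diff_left:
  assumes "f \<in> L2D" "g \<in> L2D" "h \<in> L2D"
  shows "l2_inner (\<lambda>z. f z - g z) h = l2_inner f h - l2_inner g h"
proof -
  note [measurable] = assms[THEN L2D_measurable]
  show ?thesis
    using assms by (simp add: l2_inner_eq left_diff_distrib L2D_integrable_mult)
qed

lemma l2_inner_commute:
  assumes "f \<in> L2D" "g \<in> L2D"
  shows "l2_inner g f = cnj (l2_inner f g)"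
proof -
  note [measurable] = assms[THEN L2D_measurable]
  show ?thesis
    by (simp add: l2_inner_eq complex_cnj_mult mult.commute flip: Bochner_Integration.integral_cnj)
qed

lemma l2_inner_diff_right:
  assumes "f \<in> L2D" "g \<in> L2D" "h \<in> L2D"
  shows "l2_inner h (\<lambda>z. f z - g z) = l2_inner h f - l2_inner h g"
  using assms by (simp add: l2_inner_commute[of _ h] L2D_diff l2_inner_diff_left)

lemma l2_inner_sum_left:
  assumes "\<And>i. i \<in> I \<Longrightarrow> f i \<in> L2D" "h \<in> L2D"
  shows "l2_inner (\<lambda>z. \<Sum>i\<in>I. c i * f i z) h = (\<Sum>i\<in>I. c i * l2_inner (f i) h)"
  using assms(1)
proof (induction I rule: infinite_finite_induct)
  case (insert i I)
  thus ?case
    using assms(2) by (simp add: l2_inner_add_left l2_inner_cmult_left L2D_cmult L2D_sum)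
qed (use assms(2) in \<open>auto simp: l2_inner_def\<close>)

lemma l2_inner_self: "f \<in> L2D \<Longrightarrow> l2_inner f f = of_real ((l2_norm f)\<^sup>2)"
  by (simp add: l2_norm_square l2_inner_eq L2D_measurable complex_norm_square[symmetric]
      flip: integral_complex_of_real)

lemma l2_inner_power:
  "l2_inner (\<lambda>z. z ^ m) (\<lambda>z. z ^ n) = (if m = n then 1 / (of_nat n + 1) else 0)"
proof (cases "m = n")
  case True
  have "l2_inner (\<lambda>z. z ^ n) (\<lambda>z. z ^ n) = (LINT z|area. of_real ((cmod z) ^ (2 * n)))"
  proof -
    have "z ^ n * cnj (z ^ n) = of_real ((cmod z) ^ (2 * n))" for z
      by (simp only: complex_norm_square[symmetric] norm_power)
         (simp add: power_mult[symmetric] mult.commute)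
    thus ?thesis by (simp add: l2_inner_eq)
  qed
  also have "\<dots> = 1 / (of_nat n + 1)"
    by (simp only: integral_complex_of_real integral_area_norm_power) simp
  finally show ?thesis using True by simp
next
  case False
  thus ?thesis
    using integral_area_radial_monomials[of "\<lambda>_. 1" m n] by (simp add: l2_inner_eq)
qed

lemma l2_inner_cong:
  assumes "\<And>z. z \<in> disc \<Longrightarrow> f z = f' z" "\<And>z. z \<in> disc \<Longrightarrow> g z = g' z"
  shows "l2_inner f g = l2_inner f' g'"
  unfolding l2_inner_def
  by (intro arg_cong[where f="\<lambda>x. x / of_real pi"] Bochner_Integration.integral_cong)
     (auto simp: indicator_def assms)

lemma in_disc_iff: "z \<in> disc \<longleftrightarrow> cmod z < 1"
  by (simp add: disc_def)

lemma L2D_cong: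
  assumes "\<And>z. z \<in> disc \<Longrightarrow> f z = g z" "g \<in> L2D" "f \<in> borel_measurable borel"
  shows "f \<in> L2D"
proof -
  have "integrable area (\<lambda>z. (cmod (f z))\<^sup>2) \<longleftrightarrow> integrable area (\<lambda>z. (cmod (g z))\<^sup>2)"
  proof (rule integrable_cong_AE)
    show "AE z in area. (cmod (f z))\<^sup>2 = (cmod (g z))\<^sup>2"
      using AE_area_disc by eventually_elim (simp add: assms)
  qed (use assms L2D_measurable[OF assms(2)] in measurable)
  thus ?thesis using assms by (simp add: L2D_iff)
qed

section \<open>The Bergman space as a linear space\<close>

lemma bergman_L2D: "f \<in> bergman \<Longrightarrow> f \<in> L2D"
  and bergman_outside: "f \<in> bergman \<Longrightarrow> z \<notin> disc \<Longrightarrow> f z = 0"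
  by (auto simp: bergman_def)

lemma bergman_lincomb:
  assumes "f \<in> bergman" "g \<in> bergman"
  shows "(\<lambda>z. a * f z + b * g z) \<in> bergman"
  using assms by (auto simp: bergman_def intro!: L2D_add L2D_cmult holomorphic_intros)

lemma bergman_zero: "(\<lambda>z. 0) \<in> bergman"
  by (auto simp: bergman_def L2D_zero)

lemma bergman_diff: "f \<in> bergman \<Longrightarrow> g \<in> bergman \<Longrightarrow> (\<lambda>z. f z - g z) \<in> bergman"
  using bergman_lincomb[of f g 1 "-1"] by simp

lemma bergman_sum:
  assumes "\<And>i. i \<in> I \<Longrightarrow> f i \<in> bergman"
  shows "(\<lambda>z. \<Sum>i\<in>I. c i * f i z) \<in> bergman"
  using assms
proof (induction I rule: infinite_finite_induct)
  case (insert i I)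
  thus ?case using bergman_lincomb[of "f i" "\<lambda>z. \<Sum>i\<in>I. c i * f i z" "c i" 1] by simp
qed (auto intro: bergman_zero)

lemma holomorphic_extended_by_zero_measurable:
  assumes "f holomorphic_on disc" "\<And>z. z \<notin> disc \<Longrightarrow> f z = 0"
  shows "f \<in> borel_measurable borel"
proof -
  have "(\<lambda>z. indicator disc z *\<^sub>R f z) \<in> borel_measurable borel"
    by (intro borel_measurable_continuous_on_indicator holomorphic_on_imp_continuous_on assms) simp
  also have "(\<lambda>z. indicator disc z *\<^sub>R f z) = f"
    using assms(2) by (auto simp: indicator_def fun_eq_iff)
  finally show ?thesis .
qed

section \<open>The Bergman projection\<close>

text \<open>Elements of \<open>bergman\<close> vanish outside the disc, so the monomial has to be
  cut off before it can serve as a test function. Inner products do not see the difference.\<close>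

definition disc_power :: "nat \<Rightarrow> complex \<Rightarrow> complex" where
  "disc_power n z = (if z \<in> disc then z ^ n else 0)"

lemma disc_power_bergman: "disc_power n \<in> bergman"
proof -
  have hol: "disc_power n holomorphic_on disc"
  proof (rule holomorphic_transform)
    show "(\<lambda>z. z ^ n) holomorphic_on disc" by (intro holomorphic_intros)
  qed (simp add: disc_power_def)
  have "disc_power n \<in> borel_measurable borel"
    by (rule holomorphic_extended_by_zero_measurable[OF hol]) (simp add: disc_power_def)
  thus ?thesis
    using hol by (auto simp: bergman_def disc_power_def intro!: L2D_cong[OF _ L2D_power])
qed

lemma l2_inner_disc_power: "l2_inner f (disc_power n) = l2_inner f (\<lambda>z. z ^ n)"
  by (rule l2_inner_cong) (auto simp: disc_power_def)

section \<open>Taylor coefficients and L2 norms\<close>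

lemma bergman_power_series:
  assumes "f \<in> bergman" "z \<in> disc"
  shows "(\<lambda>n. (deriv ^^ n) f 0 / fact n * z ^ n) sums f z"
  using holomorphic_power_series[of f 0 1 z] assms by (simp add: bergman_def disc_def)

text \<open>On a smaller disc |z| < R the series converges uniformly and may be integrated term by
  term; radial orthogonality leaves only the n-th term, with the factor \<open>c R\<close>. Letting
  R tend to 1 on both sides by dominated convergence removes the truncation, which is there because
  the partial sums of f have no obvious common bound on the whole disc.\<close>

lemma l2_inner_power_series:
  assumes f: "f \<in> L2D" and a: "\<And>z. z \<in> disc \<Longrightarrow> (\<lambda>k. a k * z ^ k) sums f z"
  shows "l2_inner f (\<lambda>z. z ^ n) = a n / (of_nat n + 1)"
proof -
  note [measurable] = L2D_measurable[OF f]
  define c where "c R = (LINT z|area. of_real (indicator {..<R} (cmod z)) * (z ^ n * cnj (z ^ n)))" for R :: real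
  have trunc: "(LINT z|area. of_real (indicator {..<R} (cmod z)) * (f z * cnj (z ^ n))) = a n * c R"
    if R: "0 < R" "R < 1" for R
  proof -
    let ?s = "\<lambda>N z. of_real (indicator {..<R} (cmod z)) * ((\<Sum>k<N. a k * z ^ k) * cnj (z ^ n))"
    \<comment> \<open>Convergence at the larger radius (1 + R) / 2, still inside the disc, gives
      absolute convergence at R.\<close>
    have "summable (\<lambda>k. cmod (a k * of_real R ^ k))"
    proof (rule powser_insidea)
      have "complex_of_real ((1 + R) / 2) \<in> disc"
        using R unfolding in_disc_iff norm_of_real by simp
      thus "summable (\<lambda>k. a k * of_real ((1 + R) / 2) ^ k)"
        using a sums_summable by blast
      show "cmod (of_real R) < cmod (of_real ((1 + R) / 2))"
        using R unfolding norm_of_real by simp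
    qed
    hence sm: "summable (\<lambda>k. cmod (a k) * R ^ k)"
      using R by (simp add: norm_mult norm_power)
    have "(\<lambda>N. LINT z|area. ?s N z) \<longlonglongrightarrow> (LINT z|area. of_real (indicator {..<R} (cmod z)) * (f z * cnj (z ^ n)))"
    proof (rule integral_dominated_convergence[where w = "\<lambda>_. \<Sum>k. cmod (a k) * R ^ k"])
      show "AE z in area. (\<lambda>N. ?s N z) \<longlonglongrightarrow> of_real (indicator {..<R} (cmod z)) * (f z * cnj (z ^ n))"
        using AE_area_disc
        by eventually_elim (intro tendsto_intros, use a in \<open>simp add: sums_def\<close>)
      fix N
      show "AE z in area. cmod (?s N z) \<le> (\<Sum>k. cmod (a k) * R ^ k)"
        using AE_area_disc
      proof eventually_elim
        case (elim z)
        have nn: "0 \<le> (\<Sum>k. cmod (a k) * R ^ k)" using R by (intro suminf_nonneg sm) auto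
        show ?case
        proof (cases "cmod z < R")
          case True
          have "cmod (?s N z) = cmod (\<Sum>k<N. a k * z ^ k) * cmod z ^ n"
            using True by (simp add: norm_mult norm_power)
          also have "\<dots> \<le> cmod (\<Sum>k<N. a k * z ^ k) * 1"
            using elim by (intro mult_left_mono power_le_one) (auto simp: in_disc_iff)
          also have "\<dots> \<le> (\<Sum>k<N. cmod (a k) * R ^ k)"
            using True R by (simp, intro sum_norm_le) (auto simp: norm_mult norm_power intro!: mult_left_mono power_mono)
          also have "\<dots> \<le> (\<Sum>k. cmod (a k) * R ^ k)"
            using R by (intro sum_le_suminf sm) auto
          finally show ?thesis .
        qed (use nn in auto)
      qed
    qed (auto intro: area.integrable_const)
    moreover have "eventually (\<lambda>N. (LINT z|area. ?s N z) = a n * c R) sequentially"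
      using eventually_gt_at_top[of n]
    proof eventually_elim
      case (elim N)
      let ?t = "\<lambda>k z. of_real (indicator {..<R} (cmod z)) * (z ^ k * cnj (z ^ n)) :: complex"
      have int: "integrable area (?t k)" for k
      proof (rule area.integrable_const_bound[where B=1])
        show "AE z in area. norm (?t k z) \<le> 1"
          using AE_area_disc
          by eventually_elim
             (auto simp: norm_mult norm_power in_disc_iff indicator_def intro!: mult_le_one power_le_one)
      qed measurable
      have "(LINT z|area. ?s N z) = (LINT z|area. (\<Sum>k<N. a k * ?t k z))"
        by (simp add: sum_distrib_left sum_distrib_right mult_ac)
      also have "\<dots> = (\<Sum>k<N. a k * (LINT z|area. ?t k z))"
        using int by simp
      also have "\<dots> = (\<Sum>k<N. if k = n then a n * c R else 0)"
        by (intro sum.cong refl) (use integral_area_radial_monomials[of "indicator {..<R}" _ n] in \<open>auto simp: c_def\<close>)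
      finally show ?case using elim by simp
    qed
    ultimately show ?thesis
      by (rule LIMSEQ_unique[OF _ tendsto_eventually])
  qed
  \<comment> \<open>The shift by 2 keeps every radius strictly between 0 and 1, also for i =
    0.\<close>
  define R where "R i = 1 - 1 / (real i + 2)" for i
  have R: "0 < R i" "R i < 1" for i by (auto simp: R_def field_simps)
  have R_lim: "R \<longlonglongrightarrow> 1" unfolding R_def by real_asymp
  have lim: "(\<lambda>i. LINT z|area. of_real (indicator {..<R i} (cmod z)) * g z) \<longlonglongrightarrow> (LINT z|area. g z)"
    if g: "integrable area g" for g :: "complex \<Rightarrow> complex"
  proof (rule integral_dominated_convergence[where w = "\<lambda>z. cmod (g z)"])
    show "AE z in area. (\<lambda>i. of_real (indicator {..<R i} (cmod z)) * g z) \<longlonglongrightarrow> g z"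
      using AE_area_disc
    proof eventually_elim
      case (elim z)
      hence "eventually (\<lambda>i. cmod z < R i) sequentially"
        using order_tendstoD(1)[OF R_lim] by (simp add: in_disc_iff)
      hence "eventually (\<lambda>i. of_real (indicator {..<R i} (cmod z)) * g z = g z) sequentially"
        by eventually_elim auto
      thus ?case by (rule tendsto_eventually)
    qed
    show "AE z in area. cmod (of_real (indicator {..<R i} (cmod z)) * g z) \<le> cmod (g z)" for i
      by (auto simp: norm_mult indicator_def)
  qed (use g in auto)
  have "(\<lambda>i. a n * c (R i)) \<longlonglongrightarrow> a n * l2_inner (\<lambda>z. z ^ n) (\<lambda>z. z ^ n)"
    unfolding c_def l2_inner_eq[OF L2D_measurable[OF L2D_power] L2D_measurable[OF L2D_power]]
    by (intro tendsto_mult_left lim L2D_integrable_mult L2D_power)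
  moreover have "(\<lambda>i. a n * c (R i)) \<longlonglongrightarrow> l2_inner f (\<lambda>z. z ^ n)"
    using lim[OF L2D_integrable_mult[OF f L2D_power[of n]]] trunc[OF R]
    by (simp add: l2_inner_eq)
  ultimately have "a n * l2_inner (\<lambda>z. z ^ n) (\<lambda>z. z ^ n) = l2_inner f (\<lambda>z. z ^ n)"
    by (rule LIMSEQ_unique)
  thus ?thesis by (simp add: l2_inner_power)
qed

lemma l2_norm_polynomial:
  assumes "finite I"
  shows "(l2_norm (\<lambda>z. \<Sum>k\<in>I. a k * z ^ k))\<^sup>2 = (\<Sum>k\<in>I. (cmod (a k))\<^sup>2 / (real k + 1))"
proof -
  let ?p = "\<lambda>z. \<Sum>k\<in>I. a k * z ^ k"
  have p: "?p \<in> L2D" by (intro L2D_sum L2D_cmult L2D_power)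
  have "l2_inner ?p ?p = (\<Sum>k\<in>I. a k * l2_inner (\<lambda>z. z ^ k) ?p)"
    by (intro l2_inner_sum_left L2D_power p)
  also have "\<dots> = (\<Sum>k\<in>I. of_real ((cmod (a k))\<^sup>2 / (real k + 1)))"
  proof (intro sum.cong refl)
    fix k assume k: "k \<in> I"
    have "l2_inner ?p (\<lambda>z. z ^ k) = (\<Sum>j\<in>I. a j * l2_inner (\<lambda>z. z ^ j) (\<lambda>z. z ^ k))"
      by (intro l2_inner_sum_left L2D_power)
    also have "\<dots> = (\<Sum>j\<in>I. if j = k then a k / (of_nat k + 1) else 0)"
      by (intro sum.cong) (auto simp: l2_inner_power)
    also have "\<dots> = a k / (of_nat k + 1)" using k assms by simp
    finally have "l2_inner (\<lambda>z. z ^ k) ?p = cnj (a k / (of_nat k + 1))"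
      using l2_inner_commute[OF p L2D_power] by simp
    thus "a k * l2_inner (\<lambda>z. z ^ k) ?p = of_real ((cmod (a k))\<^sup>2 / (real k + 1))"
      by (simp flip: complex_norm_square)
  qed
  finally have "complex_of_real ((l2_norm ?p)\<^sup>2) = of_real (\<Sum>k\<in>I. (cmod (a k))\<^sup>2 / (real k + 1))"
    unfolding l2_inner_self[OF p] by (simp only: of_real_sum)
  thus ?thesis by (simp only: of_real_eq_iff)
qed

lemma norm_of_nat_plus_one: "cmod (of_nat k + 1) = real k + 1"
  using norm_of_nat[of "Suc k", where 'a=complex] by (simp del: norm_of_nat add: add.commute)

text \<open>With \<open>?p\<close> the orthogonal projection of g to the span of the monomials in I,
  the sum S equals both the squared norm of \<open>?p\<close> and the inner product of
  \<open>?p\<close> with g. Cauchy-Schwarz gives S^2 <= S * |g|^2, and S cancels unless it is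
  0.\<close>

lemma bessel_inequality:
  assumes g: "g \<in> L2D" and I: "finite I"
  shows "(\<Sum>k\<in>I. (real k + 1) * (cmod (l2_inner g (\<lambda>z. z ^ k)))\<^sup>2) \<le> (l2_norm g)\<^sup>2"
proof -
  let ?c = "\<lambda>k. (of_nat k + 1) * l2_inner g (\<lambda>z. z ^ k)"
  let ?p = "\<lambda>z. \<Sum>k\<in>I. ?c k * z ^ k"
  define S where "S = (\<Sum>k\<in>I. (real k + 1) * (cmod (l2_inner g (\<lambda>z. z ^ k)))\<^sup>2)"
  have S0: "0 \<le> S" unfolding S_def by (intro sum_nonneg) auto
  have p: "?p \<in> L2D" by (intro L2D_sum L2D_cmult L2D_power)
  have "(l2_norm ?p)\<^sup>2 = (\<Sum>k\<in>I. (cmod (?c k))\<^sup>2 / (real k + 1))"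
    by (rule l2_norm_polynomial[OF I])
  also have "\<dots> = S"
    unfolding S_def
  proof (intro sum.cong refl)
    fix k
    have "cmod (of_nat k + 1) = real k + 1"
      by (rule norm_of_nat_plus_one)
    thus "(cmod (?c k))\<^sup>2 / (real k + 1) = (real k + 1) * (cmod (l2_inner g (\<lambda>z. z ^ k)))\<^sup>2"
      by (simp add: norm_mult power_mult_distrib power2_eq_square)
  qed
  finally have pS: "(l2_norm ?p)\<^sup>2 = S" .
  have "l2_inner ?p g = (\<Sum>k\<in>I. ?c k * l2_inner (\<lambda>z. z ^ k) g)"
    by (intro l2_inner_sum_left L2D_power g)
  also have "\<dots> = of_real S"
    using g by (simp add: S_def l2_inner_commute[OF g L2D_power] mult.assoc flip: complex_norm_square)
  finally have "cmod (l2_inner ?p g) = S" using S0 by simp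
  hence "S \<le> l2_norm ?p * l2_norm g" using cmod_l2_inner_le[OF p g] by simp
  hence "S\<^sup>2 \<le> (l2_norm ?p * l2_norm g)\<^sup>2" using S0 by (intro power_mono)
  hence "S * S \<le> S * (l2_norm g)\<^sup>2" by (simp only: power_mult_distrib pS power2_eq_square[of S])
  thus ?thesis
    using S0 by (cases "S = 0") (auto simp: S_def[symmetric])
qed

text \<open>Fatou's lemma applied to the partial sums.\<close>

lemma l2_norm_power_series_le:
  assumes [measurable]: "f \<in> borel_measurable borel"
    and a: "\<And>z. z \<in> disc \<Longrightarrow> (\<lambda>k. a k * z ^ k) sums f z"
    and B: "\<And>N. (\<Sum>k<N. (cmod (a k))\<^sup>2 / (real k + 1)) \<le> B"
  shows "f \<in> L2D" "(l2_norm f)\<^sup>2 \<le> B"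
proof -
  let ?p = "\<lambda>N z. \<Sum>k<N. a k * z ^ k"
  have p: "?p N \<in> L2D" for N by (intro L2D_sum L2D_cmult L2D_power)
  have "(\<integral>\<^sup>+z. ennreal ((cmod (f z))\<^sup>2) \<partial>area) = (\<integral>\<^sup>+z. liminf (\<lambda>N. ennreal ((cmod (?p N z))\<^sup>2)) \<partial>area)"
  proof (rule nn_integral_cong_AE)
    show "AE z in area. ennreal ((cmod (f z))\<^sup>2) = liminf (\<lambda>N. ennreal ((cmod (?p N z))\<^sup>2))"
      using AE_area_disc
    proof eventually_elim
      case (elim z)
      hence "(\<lambda>N. ennreal ((cmod (?p N z))\<^sup>2)) \<longlonglongrightarrow> ennreal ((cmod (f z))\<^sup>2)"
        by (intro tendsto_intros) (use a[of z] in \<open>simp_all add: sums_def\<close>)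
      thus ?case by (rule lim_imp_Liminf[symmetric, rotated]) simp
    qed
  qed
  also have "\<dots> \<le> liminf (\<lambda>N. \<integral>\<^sup>+z. ennreal ((cmod (?p N z))\<^sup>2) \<partial>area)"
    by (rule nn_integral_liminf) measurable
  also have "\<dots> \<le> ennreal B"
  proof (rule Liminf_le)
    have "(\<integral>\<^sup>+z. ennreal ((cmod (?p N z))\<^sup>2) \<partial>area) \<le> ennreal B" for N
    proof -
      have "(\<integral>\<^sup>+z. ennreal ((cmod (?p N z))\<^sup>2) \<partial>area) = ennreal ((l2_norm (?p N))\<^sup>2)"
        using p[of N] by (subst l2_norm_square[OF p], subst nn_integral_eq_integral) (auto simp: L2D_iff)
      also have "\<dots> \<le> ennreal B"
        using B[of N] by (subst l2_norm_polynomial) (auto intro: ennreal_leI)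
      finally show ?thesis .
    qed
    thus "eventually (\<lambda>N. (\<integral>\<^sup>+z. ennreal ((cmod (?p N z))\<^sup>2) \<partial>area) \<le> ennreal B) sequentially"
      by simp
  qed simp
  finally have le: "(\<integral>\<^sup>+z. ennreal ((cmod (f z))\<^sup>2) \<partial>area) \<le> ennreal B" .
  also have "\<dots> < \<infinity>" by simp
  finally show f: "f \<in> L2D" by (simp add: L2D_iff integrable_iff_bounded)
  have "0 \<le> B" using B[of 0] by simp
  have "ennreal ((l2_norm f)\<^sup>2) \<le> ennreal B"
    using le f by (subst l2_norm_square[OF f], subst nn_integral_eq_integral[symmetric]) (auto simp: L2D_iff)
  thus "(l2_norm f)\<^sup>2 \<le> B" using \<open>0 \<le> B\<close> by simp
qed

text \<open>Polynomials are dense in the Bergman space: the Taylor tail of h has squared norm at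
  most the tail of the series of |a_k|^2 / (k + 1), which converges by Bessel's inequality. As d is
  orthogonal to the Taylor polynomials, pairing d with h is the same as pairing it with arbitrarily
  small tails.\<close>

lemma l2_inner_bergman_eq_0:
  assumes d: "d \<in> L2D" "\<And>n. l2_inner d (\<lambda>z. z ^ n) = 0" and h: "h \<in> bergman"
  shows "l2_inner d h = 0"
proof -
  note hL = bergman_L2D[OF h]
  define a where "a n = (deriv ^^ n) h 0 / fact n" for n
  have a: "(\<lambda>n. a n * z ^ n) sums h z" if "z \<in> disc" for z
    using bergman_power_series[OF h that] by (simp add: a_def)
  let ?b = "\<lambda>k. (cmod (a k))\<^sup>2 / (real k + 1)"
  have "(real k + 1) * (cmod (l2_inner h (\<lambda>z. z ^ k)))\<^sup>2 = ?b k" for k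
  proof -
    have "cmod (of_nat k + 1) = real k + 1"
      by (rule norm_of_nat_plus_one)
    thus ?thesis
      by (simp add: l2_inner_power_series[OF hL a] norm_divide power_divide power2_eq_square)
  qed
  hence bb: "(\<Sum>k\<in>I. ?b k) \<le> (l2_norm h)\<^sup>2" if "finite I" for I
    using bessel_inequality[OF hL that] by simp
  have sm: "summable ?b"
    by (rule summableI_nonneg_bounded[where x="(l2_norm h)\<^sup>2"]) (use bb in auto)
  have bound: "cmod (l2_inner d h) \<le> l2_norm d * sqrt (\<Sum>k. ?b (k + N))" for N
  proof -
    let ?p = "\<lambda>z. \<Sum>k<N. a k * z ^ k"
    have p: "?p \<in> L2D" by (intro L2D_sum L2D_cmult L2D_power)
    define r where "r = (\<lambda>z. h z - ?p z)"
    have r: "r \<in> L2D" unfolding r_def by (intro L2D_diff hL p)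
    have "(l2_norm r)\<^sup>2 \<le> (\<Sum>k. ?b (k + N))"
    proof (rule l2_norm_power_series_le(2))
      show "(\<lambda>k. (if k < N then 0 else a k) * z ^ k) sums r z" if "z \<in> disc" for z
      proof -
        have "(\<lambda>k. a k * z ^ k - (if k \<in> {..<N} then a k * z ^ k else 0)) sums (h z - ?p z)"
          by (intro sums_diff a[OF that] sums_If_finite_set) auto
        also have "(\<lambda>k. a k * z ^ k - (if k \<in> {..<N} then a k * z ^ k else 0)) = (\<lambda>k. (if k < N then 0 else a k) * z ^ k)"
          by auto
        finally show ?thesis by (simp add: r_def)
      qed
      fix M
      have "(\<Sum>k<M. (cmod (if k < N then 0 else a k))\<^sup>2 / (real k + 1)) = (\<Sum>k\<in>{..<M} - {..<N}. ?b k)"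
        by (rule sum.mono_neutral_cong_right) auto
      also have "\<dots> \<le> (\<Sum>k\<in>{N..<M+N}. ?b k)"
        by (rule sum_mono2) auto
      also have "\<dots> = (\<Sum>k<M. ?b (k + N))"
        using sum.shift_bounds_nat_ivl[of ?b 0 N M] by (simp add: atLeast0LessThan)
      also have "\<dots> \<le> (\<Sum>k. ?b (k + N))"
        by (rule sum_le_suminf[OF summable_ignore_initial_segment[OF sm]]) auto
      finally show "(\<Sum>k<M. (cmod (if k < N then 0 else a k))\<^sup>2 / (real k + 1)) \<le> (\<Sum>k. ?b (k + N))" .
    qed (use r in \<open>auto intro: L2D_measurable\<close>)
    hence "l2_norm r \<le> sqrt (\<Sum>k. ?b (k + N))" by (rule real_le_rsqrt)
    moreover have "l2_inner d h = l2_inner d r"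
    proof -
      have "l2_inner ?p d = (\<Sum>k<N. a k * l2_inner (\<lambda>z. z ^ k) d)"
        by (intro l2_inner_sum_left L2D_power d)
      also have "\<dots> = 0" by (simp add: l2_inner_commute[OF d(1) L2D_power] d(2))
      finally have "l2_inner d ?p = 0" using l2_inner_commute[OF p d(1)] by simp
      thus ?thesis by (simp add: r_def l2_inner_diff_right[OF hL p d(1)])
    qed
    ultimately show ?thesis
      using cmod_l2_inner_le[OF d(1) r] mult_left_mono[OF _ l2_norm_nonneg, of "l2_norm r"]
      by (simp only:) (erule order_trans, simp only:)
  qed
  have "(\<lambda>N. l2_norm d * sqrt (\<Sum>k. ?b (k + N))) \<longlonglongrightarrow> l2_norm d * sqrt 0"
    by (intro tendsto_intros suminf_exist_split2 sm)
  hence "cmod (l2_inner d h) \<le> l2_norm d * sqrt 0"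
    by (rule LIMSEQ_le_const) (use bound in blast)
  thus ?thesis by simp
qed

section \<open>The Bergman kernel and its integral operator\<close>

lemma one_minus_mult_cnj_ne_0: "z \<in> disc \<Longrightarrow> w \<in> disc \<Longrightarrow> 1 - z * cnj w \<noteq> 0"
proof
  assume zw: "z \<in> disc" "w \<in> disc" and "1 - z * cnj w = 0"
  hence "cmod z * cmod w = 1" by (metis complex_mod_cnj eq_iff_diff_eq_0 norm_mult norm_one)
  moreover have "cmod z * cmod w < 1 * 1"
    using zw by (intro mult_strict_mono') (auto simp: in_disc_iff)
  ultimately show False by simp
qed

text \<open>Integration against the reproducing kernel of the Bergman space. The value 0 outside the
  disc matches the normalisation in \<open>bergman\<close>.\<close>

definition bergman_integral :: "(complex \<Rightarrow> complex) \<Rightarrow> complex \<Rightarrow> complex" where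
  "bergman_integral g z = (if z \<in> disc then LINT w|area. g w / (1 - z * cnj w)\<^sup>2 else 0)"

lemma bergman_kernel_bound:
  assumes "z \<in> disc" "w \<in> disc"
  shows "cmod (1 / (1 - z * cnj w)\<^sup>2) \<le> 1 / (1 - cmod z)\<^sup>2"
proof -
  have "cmod z * cmod w \<le> cmod z * 1"
    using assms by (intro mult_left_mono) (auto simp: in_disc_iff)
  hence "1 - cmod z \<le> cmod (1 - z * cnj w)"
    using norm_triangle_ineq2[of 1 "z * cnj w"] by (simp add: norm_mult)
  thus ?thesis using assms
    by (auto simp: norm_divide norm_power in_disc_iff intro!: divide_left_mono power_mono mult_pos_pos)
qed

lemma integrable_mult_bergman_kernel:
  assumes "g \<in> L2D" "z \<in> disc"
  shows "integrable area (\<lambda>w. g w / (1 - z * cnj w)\<^sup>2)"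
proof -
  have "(\<lambda>w. (1 / (1 - z * cnj w)\<^sup>2) * g w) \<in> L2D"
    by (intro L2D_mult_bounded[OF assms(1) _ bergman_kernel_bound[OF assms(2)]]) measurable
  from L2D_integrable[OF this] show ?thesis by simp
qed

text \<open>Expand the kernel as the sum of (k + 1) (z * cnj w)^k. For fixed z the partial sums are
  dominated by 1 / (1 - |z|)^2, so |g| times this constant permits integration term by term.\<close>

lemma bergman_integral_sums:
  assumes g: "g \<in> L2D" and z: "z \<in> disc"
  shows "(\<lambda>k. ((of_nat k + 1) * l2_inner g (\<lambda>w. w ^ k)) * z ^ k) sums bergman_integral g z"
proof -
  note [measurable] = L2D_measurable[OF g]
  let ?s = "\<lambda>N w. g w * (\<Sum>k<N. of_nat (Suc k) * (z * cnj w) ^ k)"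
  have z1: "norm (cmod z) < 1" using z by (simp add: in_disc_iff)
  have sr: "(\<lambda>k. real (Suc k) * cmod z ^ k) sums (1 / (1 - cmod z)\<^sup>2)"
    by (rule geometric_deriv_sums[OF z1])
  have "(\<lambda>N. LINT w|area. ?s N w) \<longlonglongrightarrow> (LINT w|area. g w / (1 - z * cnj w)\<^sup>2)"
  proof (rule integral_dominated_convergence[where w = "\<lambda>w. cmod (g w) * (1 / (1 - cmod z)\<^sup>2)"])
    show "AE w in area. (\<lambda>N. ?s N w) \<longlonglongrightarrow> g w / (1 - z * cnj w)\<^sup>2"
      using AE_area_disc
    proof eventually_elim
      case (elim w)
      have "cmod z * cmod w < 1 * 1"
        using elim z by (intro mult_strict_mono') (auto simp: in_disc_iff)
      hence "(\<lambda>k. of_nat (Suc k) * (z * cnj w) ^ k) sums (1 / (1 - z * cnj w)\<^sup>2)"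
        by (intro geometric_deriv_sums) (simp add: norm_mult)
      hence "(\<lambda>N. ?s N w) \<longlonglongrightarrow> g w * (1 / (1 - z * cnj w)\<^sup>2)"
        unfolding sums_def by (intro tendsto_intros)
      thus ?case by simp
    qed
    fix N
    show "AE w in area. cmod (?s N w) \<le> cmod (g w) * (1 / (1 - cmod z)\<^sup>2)"
      using AE_area_disc
    proof eventually_elim
      case (elim w)
      have "cmod (\<Sum>k<N. of_nat (Suc k) * (z * cnj w) ^ k) \<le> (\<Sum>k<N. real (Suc k) * cmod z ^ k)"
      proof (rule sum_norm_le)
        fix k
        have "cmod (z * cnj w) ^ k \<le> cmod z ^ k"
          using elim z by (intro power_mono) (auto simp: norm_mult in_disc_iff mult_left_le)
        thus "cmod (of_nat (Suc k) * (z * cnj w) ^ k) \<le> real (Suc k) * cmod z ^ k"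
          by (simp only: norm_mult norm_power norm_of_nat) (rule mult_left_mono, auto simp: norm_mult)
      qed
      also have "\<dots> \<le> 1 / (1 - cmod z)\<^sup>2"
        using sum_le_suminf[OF sums_summable[OF sr], of "{..<N}"] sums_unique[OF sr] by simp
      finally show ?case by (simp only: norm_mult) (rule mult_left_mono, auto)
    qed
  qed (use L2D_integrable[OF g] in auto)
  moreover have "(LINT w|area. ?s N w) = (\<Sum>k<N. ((of_nat k + 1) * l2_inner g (\<lambda>w. w ^ k)) * z ^ k)" for N
  proof -
    have "(LINT w|area. ?s N w) = (LINT w|area. (\<Sum>k<N. ((of_nat k + 1) * z ^ k) * (g w * cnj (w ^ k))))"
      by (simp add: sum_distrib_left power_mult_distrib mult_ac add.commute)
    also have "\<dots> = (\<Sum>k<N. LINT w|area. ((of_nat k + 1) * z ^ k) * (g w * cnj (w ^ k)))"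
      by (intro Bochner_Integration.integral_sum Bochner_Integration.integrable_mult_right
            L2D_integrable_mult g L2D_power)
    also have "\<dots> = (\<Sum>k<N. ((of_nat k + 1) * l2_inner g (\<lambda>w. w ^ k)) * z ^ k)"
      by (intro sum.cong refl) (simp only: integral_mult_right_zero, simp add: l2_inner_eq mult_ac)
    finally show ?thesis .
  qed
  ultimately show ?thesis using z by (simp add: sums_def bergman_integral_def)
qed

lemma bergman_integral_outside: "z \<notin> disc \<Longrightarrow> bergman_integral g z = 0"
  by (simp add: bergman_integral_def)

text \<open>All three facts are read off the Taylor coefficients \<open>?a k\<close>. Bessel's
  inequality for g bounds the sum of |a_k|^2 / (k + 1) by the squared norm of g, hence membership
  and contraction; dividing \<open>?a n\<close> by n + 1 returns the moments of g.\<close>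

lemma
  assumes g: "g \<in> L2D"
  shows bergman_integral_bergman: "bergman_integral g \<in> bergman"
    and l2_norm_bergman_integral_le: "l2_norm (bergman_integral g) \<le> l2_norm g"
    and l2_inner_bergman_integral_power:
      "l2_inner (bergman_integral g) (\<lambda>w. w ^ n) = l2_inner g (\<lambda>w. w ^ n)"
proof -
  let ?a = "\<lambda>k. (of_nat k + 1) * l2_inner g (\<lambda>w. w ^ k)"
  have hol: "bergman_integral g holomorphic_on disc"
    unfolding disc_def
    by (rule power_series_holomorphic[where a = ?a])
       (use bergman_integral_sums[OF g] in \<open>simp add: disc_def\<close>)
  have m: "bergman_integral g \<in> borel_measurable borel"
    by (rule holomorphic_extended_by_zero_measurable[OF hol bergman_integral_outside])
  have "(\<Sum>k<N. (cmod (?a k))\<^sup>2 / (real k + 1)) \<le> (l2_norm g)\<^sup>2" for N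
  proof -
    have "(\<Sum>k<N. (cmod (?a k))\<^sup>2 / (real k + 1)) = (\<Sum>k<N. (real k + 1) * (cmod (l2_inner g (\<lambda>z. z ^ k)))\<^sup>2)"
      by (intro sum.cong refl) (simp add: norm_mult norm_of_nat_plus_one power_mult_distrib power2_eq_square)
    thus ?thesis using bessel_inequality[OF g, of "{..<N}"] by simp
  qed
  note * = l2_norm_power_series_le[OF m bergman_integral_sums[OF g] this]
  show "bergman_integral g \<in> bergman"
    using * hol by (auto simp: bergman_def bergman_integral_outside)
  show "l2_norm (bergman_integral g) \<le> l2_norm g"
    by (rule power2_le_imp_le[OF _ l2_norm_nonneg]) (use * in auto)
  have "of_nat n + 1 \<noteq> (0::complex)" using norm_of_nat_plus_one[of n] by auto
  thus "l2_inner (bergman_integral g) (\<lambda>w. w ^ n) = l2_inner g (\<lambda>w. w ^ n)"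
    using l2_inner_power_series[OF *(1) bergman_integral_sums[OF g], of n] by simp
qed

text \<open>Testing against the monomials kills every Taylor coefficient. This gives the uniqueness
  part of both definite descriptions, \<open>bergman_proj\<close> and
  \<open>adjoint_op\<close>.\<close>

lemma bergman_eq_0:
  assumes d: "d \<in> bergman" "\<And>h. h \<in> bergman \<Longrightarrow> l2_inner d h = 0"
  shows "d = (\<lambda>z. 0)"
proof
  fix z
  show "d z = 0"
  proof (cases "z \<in> disc")
    case True
    have "(deriv ^^ n) d 0 / fact n = 0" for n
    proof -
      have "l2_inner d (\<lambda>z. z ^ n) = 0"
        using d(2)[OF disc_power_bergman[of n]] by (simp add: l2_inner_disc_power)
      moreover have "of_nat n + 1 \<noteq> (0::complex)" using norm_of_nat_plus_one[of n] by auto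
      ultimately show ?thesis
        using l2_inner_power_series[OF bergman_L2D[OF d(1)] bergman_power_series[OF d(1)], of n]
        by simp
    qed
    hence "(\<lambda>n. 0) sums d z"
      using bergman_power_series[OF d(1) True] by simp
    thus ?thesis using sums_unique2 sums_zero by blast
  qed (use d bergman_outside in auto)
qed

lemma l2_inner_bergman_integral:
  assumes g: "g \<in> L2D" and h: "h \<in> bergman"
  shows "l2_inner (bergman_integral g) h = l2_inner g h"
proof -
  note * = bergman_L2D[OF bergman_integral_bergman[OF g]]
  have "l2_inner (\<lambda>z. g z - bergman_integral g z) h = 0"
    by (rule l2_inner_bergman_eq_0[OF L2D_diff[OF g *] _ h])
       (simp add: l2_inner_diff_left g * L2D_power l2_inner_bergman_integral_power)
  thus ?thesis by (simp add: l2_inner_diff_left g * bergman_L2D h)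
qed

lemma bergman_proj_eq:
  assumes g: "g \<in> L2D"
  shows "bergman_proj g = bergman_integral g"
  unfolding bergman_proj_def
proof (rule the_equality)
  note B = bergman_integral_bergman[OF g]
  show "bergman_integral g \<in> bergman \<and> (\<forall>h\<in>bergman. l2_inner (\<lambda>z. g z - bergman_integral g z) h = 0)"
    using g B by (simp add: l2_inner_diff_left bergman_L2D l2_inner_bergman_integral)
  fix f assume f: "f \<in> bergman \<and> (\<forall>h\<in>bergman. l2_inner (\<lambda>z. g z - f z) h = 0)"
  have "(\<lambda>z. f z - bergman_integral g z) = (\<lambda>z. 0)"
  proof (rule bergman_eq_0)
    show "(\<lambda>z. f z - bergman_integral g z) \<in> bergman" using f B by (intro bergman_diff) auto
    fix h assume h: "h \<in> bergman"
    hence "l2_inner (\<lambda>z. g z - f z) h = 0" using f by blast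
    hence "l2_inner g h - l2_inner f h = 0"
      using f g h by (simp add: l2_inner_diff_left bergman_L2D)
    thus "l2_inner (\<lambda>z. f z - bergman_integral g z) h = 0"
      using f g h B by (simp add: l2_inner_diff_left bergman_L2D l2_inner_bergman_integral)
  qed
  thus "f = bergman_integral g" by (simp add: fun_eq_iff)
qed

lemma bergman_integral_lincomb:
  assumes "f \<in> L2D" "g \<in> L2D"
  shows "bergman_integral (\<lambda>z. a * f z + b * g z) = (\<lambda>z. a * bergman_integral f z + b * bergman_integral g z)"
proof
  fix z
  show "bergman_integral (\<lambda>z. a * f z + b * g z) z = a * bergman_integral f z + b * bergman_integral g z"
  proof (cases "z \<in> disc")
    case True
    note i = assms[THEN integrable_mult_bergman_kernel[OF _ True]]
    have "(LINT w|area. (a * f w + b * g w) / (1 - z * cnj w)\<^sup>2) =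
        (LINT w|area. a * (f w / (1 - z * cnj w)\<^sup>2) + b * (g w / (1 - z * cnj w)\<^sup>2))"
      by (simp add: add_divide_distrib)
    also have "\<dots> = a * (LINT w|area. f w / (1 - z * cnj w)\<^sup>2) + b * (LINT w|area. g w / (1 - z * cnj w)\<^sup>2)"
      using i by (simp del: times_divide_eq_right)
    finally show ?thesis using True by (simp add: bergman_integral_def)
  qed (simp add: bergman_integral_outside)
qed

lemma bergman_integral_diff:
  assumes "f \<in> L2D" "g \<in> L2D"
  shows "bergman_integral (\<lambda>z. f z - g z) = (\<lambda>z. bergman_integral f z - bergman_integral g z)"
  using bergman_integral_lincomb[OF assms, of 1 "-1"] by simp

lemma bergman_integral_sum:
  assumes "\<And>i. i \<in> I \<Longrightarrow> f i \<in> L2D"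
  shows "bergman_integral (\<lambda>z. \<Sum>i\<in>I. c i * f i z) = (\<lambda>z. \<Sum>i\<in>I. c i * bergman_integral (f i) z)"
  using assms
proof (induction I rule: infinite_finite_induct)
  case (insert i I)
  hence "(\<lambda>z. \<Sum>i\<in>I. c i * f i z) \<in> L2D" by (intro L2D_sum L2D_cmult) auto
  with insert show ?case
    using bergman_integral_lincomb[of "f i" "\<lambda>z. \<Sum>i\<in>I. c i * f i z" "c i" 1] by simp
qed (auto simp: bergman_integral_def)

section \<open>Toeplitz operators and their adjoints\<close>

lemma toeplitz_eq:
  assumes "f \<in> bergman" "u \<in> borel_measurable borel" "\<And>z. z \<in> disc \<Longrightarrow> cmod (u z) \<le> B"
  shows "toeplitz u f = bergman_integral (\<lambda>z. u z * f z)"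
  unfolding toeplitz_def by (intro bergman_proj_eq L2D_mult_bounded[OF _ assms(2,3)] bergman_L2D assms)

lemma adjoint_toeplitz_real:
  assumes g: "g \<in> bergman" and u: "u \<in> borel_measurable borel" "\<And>z. z \<in> disc \<Longrightarrow> cmod (u z) \<le> B"
    and real: "\<And>z. cnj (u z) = u z"
  shows "adjoint_op (toeplitz u) g = toeplitz u g"
  unfolding adjoint_op_def
proof (rule the_equality)
  note L = L2D_mult_bounded[OF bergman_L2D u]
  have eq: "toeplitz u f = bergman_integral (\<lambda>z. u z * f z)" if "f \<in> bergman" for f
    by (rule toeplitz_eq[OF that u])
  have adj: "l2_inner (toeplitz u f) g = l2_inner f (toeplitz u g)" if f: "f \<in> bergman" for f
  proof -
    have "l2_inner (toeplitz u f) g = l2_inner (\<lambda>z. u z * f z) g"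
      using f g by (simp add: eq l2_inner_bergman_integral L)
    also have "\<dots> = l2_inner f (\<lambda>z. u z * g z)"
      unfolding l2_inner_def by (simp add: real mult_ac)
    also have "\<dots> = cnj (l2_inner (toeplitz u g) f)"
      using f g l2_inner_commute[OF L[OF g] bergman_L2D[OF f]]
      by (simp add: eq l2_inner_bergman_integral L)
    also have "\<dots> = l2_inner f (toeplitz u g)"
      using f g by (simp add: eq L bergman_L2D bergman_integral_bergman l2_inner_commute[of "bergman_integral (\<lambda>z. u z * g z)" f])
    finally show ?thesis .
  qed
  have B: "toeplitz u g \<in> bergman" by (simp add: eq g bergman_integral_bergman L)
  show "toeplitz u g \<in> bergman \<and> (\<forall>f\<in>bergman. l2_inner (toeplitz u f) g = l2_inner f (toeplitz u g))"
    using B adj by blast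
  fix h assume h: "h \<in> bergman \<and> (\<forall>f\<in>bergman. l2_inner (toeplitz u f) g = l2_inner f h)"
  have "(\<lambda>z. h z - toeplitz u g z) = (\<lambda>z. 0)"
  proof (rule bergman_eq_0)
    show d: "(\<lambda>z. h z - toeplitz u g z) \<in> bergman" using h B by (intro bergman_diff) auto
    fix f assume f: "f \<in> bergman"
    have "l2_inner f (\<lambda>z. h z - toeplitz u g z) = 0"
      using h f adj[OF f] B by (simp add: l2_inner_diff_right bergman_L2D)
    thus "l2_inner (\<lambda>z. h z - toeplitz u g z) f = 0"
      using l2_inner_commute[OF bergman_L2D[OF f] bergman_L2D[OF d]] by simp
  qed
  thus "h = toeplitz u g" by (simp add: fun_eq_iff)
qed

section \<open>Low-rank approximation and singular values\<close>

lemma l2_norm_diff_triangle: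
  assumes "f \<in> L2D" "g \<in> L2D" "h \<in> L2D"
  shows "l2_norm (\<lambda>z. f z - g z) \<le> l2_norm (\<lambda>z. f z - h z) + l2_norm (\<lambda>z. h z - g z)"
  using l2_norm_triangle[OF L2D_diff[OF assms(1,3)] L2D_diff[OF assms(3,2)]] by simp

lemma l2_norm_diff_commute: "l2_norm (\<lambda>z. f z - g z) = l2_norm (\<lambda>z. g z - f z)"
  unfolding l2_norm_def by (simp add: norm_minus_commute)

lemma l2_norm_sum_le:
  assumes "\<And>i. i \<in> I \<Longrightarrow> f i \<in> L2D"
  shows "l2_norm (\<lambda>z. \<Sum>i\<in>I. c i * f i z) \<le> (\<Sum>i\<in>I. cmod (c i) * l2_norm (f i))"
  using assms
proof (induction I rule: infinite_finite_induct)
  case (insert i I)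
  have "l2_norm (\<lambda>z. c i * f i z + (\<Sum>i\<in>I. c i * f i z)) \<le> l2_norm (\<lambda>z. c i * f i z) + l2_norm (\<lambda>z. \<Sum>i\<in>I. c i * f i z)"
    using insert by (intro l2_norm_triangle L2D_cmult L2D_sum) auto
  thus ?case using insert by (simp add: l2_norm_cmult)
qed (auto simp: l2_norm_zero)

text \<open>In \<open>rank_le\<close> the coefficients may depend on f in any way. Here they are
  linear functionals with explicit bounds, so that the operator is linear and bounded, and so that
  bounded sequences of functions yield bounded sequences of coefficients in the compactness
  proof.\<close>

definition bounded_rank_form ::
  "nat \<Rightarrow> ((complex \<Rightarrow> complex) \<Rightarrow> (complex \<Rightarrow> complex)) \<Rightarrow> (nat \<Rightarrow> complex \<Rightarrow> complex) \<Rightarrow>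
    (nat \<Rightarrow> (complex \<Rightarrow> complex) \<Rightarrow> complex) \<Rightarrow> (nat \<Rightarrow> real) \<Rightarrow> bool" where
  "bounded_rank_form n K e c C \<longleftrightarrow>
     (\<forall>i<n. e i \<in> bergman) \<and>
     (\<forall>i<n. \<forall>f\<in>bergman. \<forall>g\<in>bergman. \<forall>a b. c i (\<lambda>z. a * f z + b * g z) = a * c i f + b * c i g) \<and>
     (\<forall>i<n. \<forall>f\<in>bergman. cmod (c i f) \<le> C i * l2_norm f) \<and>
     (\<forall>f\<in>bergman. K f = (\<lambda>z. \<Sum>i<n. c i f * e i z))"

lemma bounded_rank_formD:
  assumes "bounded_rank_form n K e c C"
  shows "i < n \<Longrightarrow> e i \<in> bergman"
    and "i < n \<Longrightarrow> f \<in> bergman \<Longrightarrow> g \<in> bergman \<Longrightarrow> c i (\<lambda>z. a * f z + b * g z) = a * c i f + b * c i g"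
    and "i < n \<Longrightarrow> f \<in> bergman \<Longrightarrow> cmod (c i f) \<le> C i * l2_norm f"
    and "f \<in> bergman \<Longrightarrow> K f = (\<lambda>z. \<Sum>i<n. c i f * e i z)"
  using assms unfolding bounded_rank_form_def by blast+

definition bounded_rank_le :: "nat \<Rightarrow> ((complex \<Rightarrow> complex) \<Rightarrow> (complex \<Rightarrow> complex)) \<Rightarrow> bool" where
  "bounded_rank_le n K \<longleftrightarrow> (\<exists>e c C. bounded_rank_form n K e c C)"

lemma
  assumes "bounded_rank_le n K"
  shows bounded_rank_le_linear: "linear_on_bergman K"
    and bounded_rank_le_bounded: "bounded_on_bergman K"
    and bounded_rank_le_rank_le: "n \<le> m \<Longrightarrow> rank_le m K"
proof -
  from assms obtain e c C where form: "bounded_rank_form n K e c C"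
    unfolding bounded_rank_le_def by blast
  note e = bounded_rank_formD(1)[OF form] and lin = bounded_rank_formD(2)[OF form]
    and C = bounded_rank_formD(3)[OF form] and K = bounded_rank_formD(4)[OF form]
  show "linear_on_bergman K"
    unfolding linear_on_bergman_def
  proof (intro conjI ballI allI)
    fix f g a b assume fg: "f \<in> bergman" "g \<in> bergman"
    show "K (\<lambda>z. a * f z + b * g z) = (\<lambda>z. a * K f z + b * K g z)"
      using fg by (simp add: K bergman_lincomb lin sum_distrib_left sum.distrib[symmetric] algebra_simps)
  qed (auto simp: K intro!: bergman_sum e)
  have "l2_norm (K f) \<le> (\<Sum>i<n. C i * l2_norm (e i)) * l2_norm f" if f: "f \<in> bergman" for f
  proof -
    have "l2_norm (K f) \<le> (\<Sum>i<n. cmod (c i f) * l2_norm (e i))"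
      unfolding K[OF f] by (intro l2_norm_sum_le bergman_L2D e) auto
    also have "\<dots> \<le> (\<Sum>i<n. (C i * l2_norm f) * l2_norm (e i))"
      by (intro sum_mono mult_right_mono C f l2_norm_nonneg) auto
    also have "\<dots> = (\<Sum>i<n. C i * l2_norm (e i)) * l2_norm f"
      by (simp add: sum_distrib_left sum_distrib_right mult_ac)
    finally show ?thesis .
  qed
  thus "bounded_on_bergman K" unfolding bounded_on_bergman_def by blast
  assume nm: "n \<le> m"
  \<comment> \<open>Zero coefficients pad the representation from n to m terms.\<close>
  have "K f = (\<lambda>z. \<Sum>i<m. (if i < n then c i f else 0) * e i z)" if "f \<in> bergman" for f
  proof
    fix z
    show "K f z = (\<Sum>i<m. (if i < n then c i f else 0) * e i z)"
      unfolding K[OF that] by (rule sum.mono_neutral_cong_left) (use nm in auto)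
  qed
  thus "rank_le m K"
    unfolding rank_le_def by (intro exI[of _ e] ballI exI) assumption
qed

definition low_rank_approximable :: "nat \<Rightarrow> real \<Rightarrow> ((complex \<Rightarrow> complex) \<Rightarrow> (complex \<Rightarrow> complex)) \<Rightarrow> bool" where
  "low_rank_approximable r \<eta> T \<longleftrightarrow> (\<exists>s K. s \<le> r \<and> bounded_rank_le s K \<and>
     (\<forall>f\<in>bergman. l2_norm (\<lambda>z. T f z - K f z) \<le> \<eta> * l2_norm f))"

text \<open>The composition of two Toeplitz operators with both projections written as kernel
  integrals. It agrees with the actual composition on \<open>bergman\<close> when the symbols are
  measurable and bounded.\<close>

definition toeplitz_product :: "(complex \<Rightarrow> complex) \<Rightarrow> (complex \<Rightarrow> complex) \<Rightarrow> (complex \<Rightarrow> complex) \<Rightarrow> complex \<Rightarrow> complex" where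
  "toeplitz_product u v f = bergman_integral (\<lambda>z. u z * bergman_integral (\<lambda>z. v z * f z) z)"

section \<open>Operator norm, singular values and compactness\<close>

lemma op_norm_le:
  assumes "\<And>f. f \<in> bergman \<Longrightarrow> l2_norm (B f) \<le> \<delta> * l2_norm f" "0 \<le> \<delta>"
  shows "op_norm B \<le> \<delta>"
  unfolding op_norm_def
proof (rule cSup_least)
  show "{l2_norm (B f) |f. f \<in> bergman \<and> l2_norm f \<le> 1} \<noteq> {}"
    using bergman_zero l2_norm_zero by force
  fix x assume "x \<in> {l2_norm (B f) |f. f \<in> bergman \<and> l2_norm f \<le> 1}"
  then obtain f where f: "f \<in> bergman" "l2_norm f \<le> 1" "x = l2_norm (B f)" by auto
  have "x \<le> \<delta> * l2_norm f" using assms(1) f by simp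
  also have "\<dots> \<le> \<delta> * 1" using f assms by (intro mult_left_mono) auto
  finally show "x \<le> \<delta>" by simp
qed

text \<open>The estimate bounds the set in \<open>op_norm\<close> from above; without such a bound
  its real supremum carries no information. The function 0 then supplies a nonnegative
  element.\<close>

lemma op_norm_nonneg:
  assumes "\<And>f. f \<in> bergman \<Longrightarrow> l2_norm (B f) \<le> \<delta> * l2_norm f"
  shows "0 \<le> op_norm B"
proof -
  have "l2_norm (B (\<lambda>z. 0)) \<le> op_norm B"
    unfolding op_norm_def
  proof (rule cSup_upper)
    show "bdd_above {l2_norm (B f) |f. f \<in> bergman \<and> l2_norm f \<le> 1}"
    proof (rule bdd_aboveI)
      fix x assume "x \<in> {l2_norm (B f) |f. f \<in> bergman \<and> l2_norm f \<le> 1}"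
      then obtain f where f: "f \<in> bergman" "l2_norm f \<le> 1" "x = l2_norm (B f)" by auto
      have "x \<le> \<delta> * l2_norm f" using assms(1) f by simp
      also have "\<dots> \<le> \<bar>\<delta>\<bar> * 1" using f by (intro mult_mono l2_norm_nonneg) auto
      finally show "x \<le> \<bar>\<delta>\<bar>" by simp
    qed
  qed (use bergman_zero l2_norm_zero in force)
  thus ?thesis using l2_norm_nonneg[of "B (\<lambda>z. 0)"] by linarith
qed

text \<open>The infimum in \<open>sing_val\<close> is usable because its set is nonempty (take K =
  0) and bounded below by 0, as A - K is bounded for every admissible K.\<close>

lemma
  assumes A: "linear_on_bergman A" "bounded_on_bergman A"
  shows sing_val_nonneg: "0 \<le> sing_val n A"
    and sing_val_le: "low_rank_approximable r \<delta> A \<Longrightarrow> r \<le> n \<Longrightarrow> 0 \<le> \<delta> \<Longrightarrow> sing_val n A \<le> \<delta>"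
proof -
  let ?S = "{op_norm (\<lambda>f z. A f z - K f z) | K. linear_on_bergman K \<and> bounded_on_bergman K \<and> rank_le n K}"
  have nonneg: "0 \<le> op_norm (\<lambda>f z. A f z - K f z)" if K: "linear_on_bergman K" "bounded_on_bergman K" for K
  proof -
    from A(2) K(2) obtain C D where
      CD: "\<And>f. f \<in> bergman \<Longrightarrow> l2_norm (A f) \<le> C * l2_norm f" "\<And>f. f \<in> bergman \<Longrightarrow> l2_norm (K f) \<le> D * l2_norm f"
      unfolding bounded_on_bergman_def by blast
    have "l2_norm (\<lambda>z. A f z - K f z) \<le> (C + D) * l2_norm f" if f: "f \<in> bergman" for f
    proof -
      have "A f \<in> L2D" "K f \<in> L2D" using f A K by (auto simp: linear_on_bergman_def bergman_L2D)
      from l2_norm_diff_triangle[OF this L2D_zero]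
      have "l2_norm (\<lambda>z. A f z - K f z) \<le> l2_norm (A f) + l2_norm (K f)"
        using l2_norm_diff_commute[of "\<lambda>_. 0" "K f"] by simp
      thus ?thesis using CD[OF f] by (simp add: distrib_right)
    qed
    thus ?thesis by (rule op_norm_nonneg)
  qed
  have zero: "bounded_rank_le 0 (\<lambda>f z. 0)" by (auto simp: bounded_rank_le_def bounded_rank_form_def)
  show "0 \<le> sing_val n A"
    unfolding sing_val_def
  proof (rule cInf_greatest)
    show "?S \<noteq> {}"
      using bounded_rank_le_linear[OF zero] bounded_rank_le_bounded[OF zero] bounded_rank_le_rank_le[OF zero]
      by blast
  qed (use nonneg in auto)
  assume "low_rank_approximable r \<delta> A" and r: "r \<le> n" and \<delta>: "0 \<le> \<delta>"
  then obtain m K where K: "bounded_rank_le m K" "m \<le> n"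
    and le: "\<And>f. f \<in> bergman \<Longrightarrow> l2_norm (\<lambda>z. A f z - K f z) \<le> \<delta> * l2_norm f"
    unfolding low_rank_approximable_def using order_trans by blast
  have "sing_val n A \<le> op_norm (\<lambda>f z. A f z - K f z)"
    unfolding sing_val_def
  proof (rule cInf_lower)
    show "bdd_below ?S" by (rule bdd_belowI[of _ 0]) (use nonneg in auto)
  qed (use bounded_rank_le_linear[OF K(1)] bounded_rank_le_bounded[OF K(1)] bounded_rank_le_rank_le[OF K(1,2)] in blast)
  also have "\<dots> \<le> \<delta>" by (rule op_norm_le[OF le \<delta>])
  finally show "sing_val n A \<le> \<delta>" .
qed

text \<open>A diagonal argument: the coefficients of all approximants \<open>K p\<close> form
  countably many bounded scalar sequences, so one subsequence makes all of them converge. Along it,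
  the images under A stay within eps / 2 of a fixed function, the limit for a single good p.\<close>

lemma compact_op_if_approximable:
  assumes A: "linear_on_bergman A"
    and approx: "\<And>p. low_rank_approximable (R p) (\<delta> p) A"
    and \<delta>: "\<delta> \<longlonglongrightarrow> 0"
  shows "compact_op A"
  unfolding compact_op_def
proof (intro conjI allI impI A)
  fix u :: "nat \<Rightarrow> complex \<Rightarrow> complex"
  assume "(\<forall>n. u n \<in> bergman) \<and> (\<exists>M. \<forall>n. l2_norm (u n) \<le> M)"
  then obtain M where u: "\<And>n. u n \<in> bergman" and M: "\<And>n. l2_norm (u n) \<le> M" by auto
  have M0: "0 \<le> M" using M[of 0] l2_norm_nonneg[of "u 0"] by linarith
  from approx obtain N K where K: "\<And>p. bounded_rank_le (N p) (K p)"
    and le: "\<And>p f. f \<in> bergman \<Longrightarrow> l2_norm (\<lambda>z. A f z - K p f z) \<le> \<delta> p * l2_norm f"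
    unfolding low_rank_approximable_def by metis
  from K obtain e c C where form: "\<And>p. bounded_rank_form (N p) (K p) (e p) (c p) (C p)"
    unfolding bounded_rank_le_def by metis
  note e = bounded_rank_formD(1)[OF form] and C = bounded_rank_formD(3)[OF form]
    and Kf = bounded_rank_formD(4)[OF form]
  \<comment> \<open>Rescaling puts all coefficient sequences into the unit ball, the common bound
    that the diagonal extraction asks for. The summand 1 keeps the divisor positive.\<close>
  define x where "x n = (\<lambda>(p, i). c p i (u n) /\<^sub>R (\<bar>C p i\<bar> * M + 1))" for n
  have pos: "0 < \<bar>C p i\<bar> * M + 1" for p i using M0 by (intro add_nonneg_pos) auto
  have x1: "norm (x n q) \<le> 1" if "q \<in> {(p, i). i < N p}" for n q
  proof -
    obtain p i where q: "q = (p, i)" "i < N p" using \<open>q \<in> {(p, i). i < N p}\<close> by auto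
    have "cmod (c p i (u n)) \<le> C p i * l2_norm (u n)" by (intro C q u)
    also have "\<dots> \<le> \<bar>C p i\<bar> * M" by (intro mult_mono M l2_norm_nonneg) auto
    finally show ?thesis using pos[of p i] by (simp add: x_def q field_simps)
  qed
  obtain r where r: "strict_mono (r :: nat \<Rightarrow> nat)"
    and lim: "\<And>q. q \<in> {(p, i). i < N p} \<Longrightarrow> \<exists>l. (\<lambda>n. x (r n) q) \<longlonglongrightarrow> l"
    by (rule function_convergent_subsequence[of "{(p, i). i < N p}" x 1]) (use x1 in auto)
  have "\<exists>l. (\<lambda>n. c p i (u (r n))) \<longlonglongrightarrow> l" if "i < N p" for p i
  proof -
    from lim[of "(p, i)"] that obtain l where "(\<lambda>n. x (r n) (p, i)) \<longlonglongrightarrow> l" by auto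
    hence "(\<lambda>n. (\<bar>C p i\<bar> * M + 1) *\<^sub>R x (r n) (p, i)) \<longlonglongrightarrow> (\<bar>C p i\<bar> * M + 1) *\<^sub>R l"
      by (intro tendsto_intros)
    thus ?thesis using pos[of p i] by (auto simp: x_def)
  qed
  hence conv: "convergent (\<lambda>n. c p i (u (r n)))" if "i < N p" for p i
    unfolding convergent_def using that by blast
  define l where "l p i = lim (\<lambda>n. c p i (u (r n)))" for p i
  have l: "(\<lambda>n. c p i (u (r n))) \<longlonglongrightarrow> l p i" if "i < N p" for p i
    using conv[OF that] unfolding l_def convergent_LIMSEQ_iff .
  show "\<exists>r :: nat \<Rightarrow> nat. strict_mono r \<and> (\<forall>\<epsilon>>0. \<exists>N. \<forall>m\<ge>N. \<forall>n\<ge>N. l2_norm (\<lambda>z. A (u (r m)) z - A (u (r n)) z) < \<epsilon>)"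
  proof (intro exI[of _ r] conjI allI impI r)
    fix \<epsilon> :: real assume \<epsilon>: "\<epsilon> > 0"
    have "(\<lambda>p. \<delta> p * M) \<longlonglongrightarrow> 0 * M" by (intro tendsto_intros \<delta>)
    hence "eventually (\<lambda>p. \<delta> p * M < \<epsilon> / 4) sequentially"
      using \<epsilon> by (intro order_tendstoD) auto
    then obtain p where p: "\<delta> p * M < \<epsilon> / 4"
      using eventually_happens'[OF sequentially_bot] by blast
    \<comment> \<open>The limit of \<open>K p (u (r n))\<close>; comparing with it replaces a
      comparison of two varying images.\<close>
    define L where "L z = (\<Sum>i<N p. l p i * e p i z)" for z
    have L: "L \<in> L2D" unfolding L_def by (intro L2D_sum L2D_cmult bergman_L2D e) auto
    have Au: "A (u n) \<in> L2D" for n using A u by (auto simp: linear_on_bergman_def bergman_L2D)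
    have Ku: "K p (u n) \<in> L2D" for n
      using bounded_rank_le_linear[OF K[of p]] u by (auto simp: linear_on_bergman_def bergman_L2D)
    define b where "b n = (\<Sum>i<N p. cmod (c p i (u (r n)) - l p i) * l2_norm (e p i))" for n
    have "b \<longlonglongrightarrow> (\<Sum>i<N p. cmod (l p i - l p i) * l2_norm (e p i))"
      unfolding b_def by (intro tendsto_intros l) auto
    hence "eventually (\<lambda>n. b n < \<epsilon> / 4) sequentially"
      using \<epsilon> by (intro order_tendstoD) auto
    then obtain n0 where n0: "\<And>n. n \<ge> n0 \<Longrightarrow> b n < \<epsilon> / 4"
      by (auto simp: eventually_sequentially)
    have close: "l2_norm (\<lambda>z. A (u (r n)) z - L z) < \<epsilon> / 2" if "n \<ge> n0" for n
    proof -
      have "l2_norm (\<lambda>z. A (u (r n)) z - L z) \<le>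
          l2_norm (\<lambda>z. A (u (r n)) z - K p (u (r n)) z) + l2_norm (\<lambda>z. K p (u (r n)) z - L z)"
        by (intro l2_norm_diff_triangle Au Ku L)
      moreover have "l2_norm (\<lambda>z. A (u (r n)) z - K p (u (r n)) z) < \<epsilon> / 4"
      proof -
        \<comment> \<open>The sign of \<open>\<delta> p\<close> is unknown, so the product with the
          norm is compared with 0 as well.\<close>
        have "\<delta> p * l2_norm (u (r n)) \<le> max 0 (\<delta> p * M)"
        proof (cases "\<delta> p \<ge> 0")
          case True
          thus ?thesis using mult_left_mono[OF M True, of "r n"] by linarith
        next
          case False
          hence "\<delta> p * l2_norm (u (r n)) \<le> 0" using l2_norm_nonneg by (simp add: mult_nonpos_nonneg)
          thus ?thesis by linarith
        qed
        thus ?thesis using le[OF u, of "r n" p] p \<epsilon> by linarith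
      qed
      moreover have "l2_norm (\<lambda>z. K p (u (r n)) z - L z) \<le> b n"
      proof -
        have "(\<lambda>z. K p (u (r n)) z - L z) = (\<lambda>z. \<Sum>i<N p. (c p i (u (r n)) - l p i) * e p i z)"
          by (simp add: Kf u L_def left_diff_distrib sum_subtractf)
        thus ?thesis unfolding b_def using l2_norm_sum_le[of "{..<N p}" "e p"] e bergman_L2D by auto
      qed
      ultimately show ?thesis using n0[OF that] by linarith
    qed
    show "\<exists>N. \<forall>m\<ge>N. \<forall>n\<ge>N. l2_norm (\<lambda>z. A (u (r m)) z - A (u (r n)) z) < \<epsilon>"
    proof (intro exI[of _ n0] allI impI)
      fix m n assume "n0 \<le> m" "n0 \<le> n"
      thus "l2_norm (\<lambda>z. A (u (r m)) z - A (u (r n)) z) < \<epsilon>"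
        using l2_norm_diff_triangle[OF Au[of "r m"] Au[of "r n"] L] close[of m] close[of n]
          l2_norm_diff_commute[of L "A (u (r n))"] by linarith
    qed
  qed
qed

text \<open>Only the kernel of the inner projection is replaced. The separable sum turns it into a
  combination of card I functions of z with functionals of f as coefficients; multiplying by u and
  projecting preserves this form. The error \<open>D\<close> before the outer projection is at most
  eta times the L1 norm of v f at every point, hence at most eta times the norm of f in L2, and the
  outer projection does not increase it. The kernel estimate is required only where both symbols are
  nonzero.\<close>

lemma separable_kernel_approximation:
  fixes a b :: "'i \<Rightarrow> complex \<Rightarrow> complex"
  assumes u: "u \<in> borel_measurable borel" "\<And>z. z \<in> disc \<Longrightarrow> cmod (u z) \<le> 1"
    and v: "v \<in> borel_measurable borel" "\<And>z. z \<in> disc \<Longrightarrow> cmod (v z) \<le> 1"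
    and I: "finite I"
    and a: "\<And>i. i \<in> I \<Longrightarrow> (\<lambda>z. u z * a i z) \<in> L2D"
    and b: "\<And>i. i \<in> I \<Longrightarrow> b i \<in> borel_measurable borel" "\<And>i w. i \<in> I \<Longrightarrow> w \<in> disc \<Longrightarrow> cmod (b i w) \<le> \<beta> i"
    and approx: "\<And>z w. z \<in> disc \<Longrightarrow> w \<in> disc \<Longrightarrow> u z \<noteq> 0 \<Longrightarrow> v w \<noteq> 0 \<Longrightarrow>
        cmod (1 / (1 - z * cnj w)\<^sup>2 - (\<Sum>i\<in>I. a i z * b i w)) \<le> \<eta>"
    and \<eta>: "0 \<le> \<eta>"
  shows "low_rank_approximable (card I) \<eta> (toeplitz_product u v)"
proof -
  define c where "c i f = (LINT w|area. b i w * (v w * f w))" for i f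
  define e where "e i = bergman_integral (\<lambda>z. u z * a i z)" for i
  define K where "K f z = (\<Sum>i\<in>I. c i f * e i z)" for f z
  have vf: "(\<lambda>z. v z * f z) \<in> L2D" if "f \<in> bergman" for f
    by (rule L2D_mult_bounded[OF bergman_L2D[OF that] v])
  have vf_le: "l2_norm (\<lambda>z. v z * f z) \<le> l2_norm f" if "f \<in> bergman" for f
    using l2_norm_mult_le[OF bergman_L2D[OF that] v] by simp
  have bvf: "(\<lambda>w. b i w * (v w * f w)) \<in> L2D" if "f \<in> bergman" "i \<in> I" for f i
    by (rule L2D_mult_bounded[OF vf[OF that(1)] b(1)[OF that(2)] b(2)[OF that(2)]])
  \<comment> \<open>\<open>bounded_rank_form\<close> is indexed by an initial segment of the
    naturals, so the index set is enumerated.\<close>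
  obtain h where h: "bij_betw h {..<card I} I"
    using ex_bij_betw_nat_finite[OF I] by (auto simp: atLeast0LessThan)
  hence hI: "h j \<in> I" if "j < card I" for j using that bij_betwE by fastforce
  have "bounded_rank_le (card I) K"
    unfolding bounded_rank_le_def bounded_rank_form_def
  proof (intro exI[of _ "e \<circ> h"] exI[of _ "c \<circ> h"] exI[of _ "\<beta> \<circ> h"] conjI allI impI ballI)
    fix j assume j: "j < card I"
    show "(e \<circ> h) j \<in> bergman" unfolding e_def o_def by (intro bergman_integral_bergman a hI j)
    show "(c \<circ> h) j (\<lambda>z. x * f z + y * g z) = x * (c \<circ> h) j f + y * (c \<circ> h) j g"
      if f: "f \<in> bergman" and g: "g \<in> bergman" for f g x y
    proof -
      let ?i = "h j"
      have "c ?i (\<lambda>z. x * f z + y * g z) = (LINT w|area. x * (b ?i w * (v w * f w)) + y * (b ?i w * (v w * g w)))"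
        unfolding c_def by (simp add: algebra_simps)
      also have "\<dots> = (LINT w|area. x * (b ?i w * (v w * f w))) + (LINT w|area. y * (b ?i w * (v w * g w)))"
        by (intro Bochner_Integration.integral_add Bochner_Integration.integrable_mult_right L2D_integrable bvf f g hI j)
      also have "\<dots> = x * c ?i f + y * c ?i g"
        by (simp only: c_def integral_mult_right_zero)
      finally show ?thesis by simp
    qed
    show "cmod ((c \<circ> h) j f) \<le> (\<beta> \<circ> h) j * l2_norm f" if f: "f \<in> bergman" for f
    proof -
      let ?i = "h j"
      have \<beta>: "0 \<le> \<beta> ?i" using order.trans[OF norm_ge_zero b(2)[OF hI[OF j], of 0]] by (simp add: disc_def)
      have "cmod (c ?i f) \<le> (LINT w|area. cmod (b ?i w * (v w * f w)))"
        unfolding c_def by (rule integral_norm_bound)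
      also have "\<dots> \<le> l2_norm (\<lambda>w. b ?i w * (v w * f w))"
        by (intro integral_norm_le_l2_norm bvf f hI j)
      also have "\<dots> \<le> \<beta> ?i * l2_norm (\<lambda>w. v w * f w)"
        by (intro l2_norm_mult_le vf f b hI j)
      also have "\<dots> \<le> \<beta> ?i * l2_norm f" by (intro mult_left_mono vf_le f \<beta>)
      finally show ?thesis by simp
    qed
  next
    fix f
    show "K f = (\<lambda>z. \<Sum>i<card I. (c \<circ> h) i f * (e \<circ> h) i z)"
      unfolding K_def using sum.reindex_bij_betw[OF h, of "\<lambda>i. c i f * e i _"] by (simp add: fun_eq_iff)
  qed
  moreover have "l2_norm (\<lambda>z. toeplitz_product u v f z - K f z) \<le> \<eta> * l2_norm f"
    if f: "f \<in> bergman" for f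
  proof -
    define G where "G = bergman_integral (\<lambda>z. v z * f z)"
    have G: "G \<in> L2D" unfolding G_def by (intro bergman_L2D bergman_integral_bergman vf f)
    have uG: "(\<lambda>z. u z * G z) \<in> L2D" by (rule L2D_mult_bounded[OF G u])
    have S: "(\<lambda>z. \<Sum>i\<in>I. c i f * (u z * a i z)) \<in> L2D" by (intro L2D_sum L2D_cmult a)
    define D where "D z = u z * G z - (\<Sum>i\<in>I. c i f * (u z * a i z))" for z
    have D: "D \<in> L2D" unfolding D_def by (intro L2D_diff uG S)
    have "bergman_integral D = (\<lambda>z. bergman_integral (\<lambda>z. u z * G z) z - K f z)"
      unfolding D_def bergman_integral_diff[OF uG S] K_def e_def
      by (subst bergman_integral_sum[OF a]) auto
    hence "l2_norm (\<lambda>z. bergman_integral (\<lambda>z. u z * G z) z - K f z) = l2_norm (bergman_integral D)"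
      by simp
    also have "\<dots> \<le> l2_norm D" by (rule l2_norm_bergman_integral_le[OF D])
    also have "\<dots> \<le> \<eta> * l2_norm f"
    proof (rule l2_norm_le_const[OF L2D_measurable[OF D]])
      fix z assume z: "z \<in> disc"
      show "cmod (D z) \<le> \<eta> * l2_norm f"
      proof (cases "u z = 0")
        case True
        thus ?thesis using \<eta> l2_norm_nonneg[of f] by (simp add: D_def)
      next
        case False
        let ?E = "\<lambda>w. 1 / (1 - z * cnj w)\<^sup>2 - (\<Sum>i\<in>I. a i z * b i w)"
        note ik = integrable_mult_bergman_kernel[OF vf[OF f] z]
        have is': "integrable area (\<lambda>w. \<Sum>i\<in>I. a i z * (b i w * (v w * f w)))"
          by (intro Bochner_Integration.integrable_sum Bochner_Integration.integrable_mult_right L2D_integrable bvf f)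
        have "D z = u z * (G z - (\<Sum>i\<in>I. a i z * c i f))"
          by (simp add: D_def right_diff_distrib sum_distrib_left mult_ac)
        also have "G z - (\<Sum>i\<in>I. a i z * c i f) =
            (LINT w|area. v w * f w / (1 - z * cnj w)\<^sup>2) - (LINT w|area. (\<Sum>i\<in>I. a i z * (b i w * (v w * f w))))"
        proof -
          have "(LINT w|area. (\<Sum>i\<in>I. a i z * (b i w * (v w * f w)))) = (\<Sum>i\<in>I. LINT w|area. a i z * (b i w * (v w * f w)))"
            by (intro Bochner_Integration.integral_sum Bochner_Integration.integrable_mult_right L2D_integrable bvf f)
          also have "\<dots> = (\<Sum>i\<in>I. a i z * c i f)" by (simp only: c_def integral_mult_right_zero)
          finally show ?thesis using z by (simp add: G_def bergman_integral_def)
        qed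
        also have "\<dots> = (LINT w|area. v w * f w / (1 - z * cnj w)\<^sup>2 - (\<Sum>i\<in>I. a i z * (b i w * (v w * f w))))"
          by (rule Bochner_Integration.integral_diff[OF ik is', symmetric])
        also have "\<dots> = (LINT w|area. (v w * f w) * ?E w)"
          by (intro Bochner_Integration.integral_cong refl)
             (simp add: right_diff_distrib sum_distrib_left mult_ac)
        finally have Dz: "D z = u z * (LINT w|area. (v w * f w) * ?E w)" .
        have "cmod (LINT w|area. (v w * f w) * ?E w) \<le> (LINT w|area. \<eta> * cmod (v w * f w))"
        proof (rule order.trans[OF integral_norm_bound integral_mono_AE])
          have "integrable area (\<lambda>w. v w * f w / (1 - z * cnj w)\<^sup>2 - (\<Sum>i\<in>I. a i z * (b i w * (v w * f w))))"
            by (rule Bochner_Integration.integrable_diff[OF ik is'])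
          also have "(\<lambda>w. v w * f w / (1 - z * cnj w)\<^sup>2 - (\<Sum>i\<in>I. a i z * (b i w * (v w * f w)))) = (\<lambda>w. (v w * f w) * ?E w)"
            by (simp add: fun_eq_iff right_diff_distrib sum_distrib_left mult_ac)
          finally show "integrable area (\<lambda>w. cmod ((v w * f w) * ?E w))"
            by (rule integrable_norm)
          show "integrable area (\<lambda>w. \<eta> * cmod (v w * f w))"
            using L2D_integrable[OF vf[OF f]] by auto
          show "AE w in area. cmod ((v w * f w) * ?E w) \<le> \<eta> * cmod (v w * f w)"
            using AE_area_disc
          proof eventually_elim
            case (elim w)
            show ?case
            proof (cases "v w = 0")
              case False
              thus ?thesis
                using approx[OF z elim \<open>u z \<noteq> 0\<close> False]
                by (subst norm_mult, subst mult.commute) (rule mult_right_mono, auto)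
            qed auto
          qed
        qed
        also have "\<dots> = \<eta> * (LINT w|area. cmod (v w * f w))" by simp
        also have "\<dots> \<le> \<eta> * l2_norm f"
          by (intro mult_left_mono \<eta> order.trans[OF integral_norm_le_l2_norm[OF vf[OF f]] vf_le[OF f]])
        finally have *: "cmod (LINT w|area. (v w * f w) * ?E w) \<le> \<eta> * l2_norm f" .
        have "cmod (D z) \<le> 1 * (\<eta> * l2_norm f)"
          unfolding Dz norm_mult by (intro mult_mono u z *) auto
        thus ?thesis by simp
      qed
    qed
    finally show ?thesis by (simp add: G_def toeplitz_product_def)
  qed
  ultimately show ?thesis unfolding low_rank_approximable_def by blast
qed

section \<open>The Bergman kernel between two sectors\<close>

lemma sum_Suc_power_closed_form:
  fixes x :: "'a :: comm_ring_1"
  shows "(1 - x)\<^sup>2 * (\<Sum>l<m. (of_nat l + 1) * x ^ l) = 1 - (of_nat m + 1) * x ^ m + of_nat m * x ^ Suc m"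
proof (induction m)
  case (Suc m)
  have "(1 - x)\<^sup>2 * (\<Sum>l<Suc m. (of_nat l + 1) * x ^ l) =
      (1 - (of_nat m + 1) * x ^ m + of_nat m * x ^ Suc m) + (1 - x)\<^sup>2 * ((of_nat m + 1) * x ^ m)"
    by (simp only: sum.lessThan_Suc distrib_left Suc.IH)
  also have "\<dots> = 1 - (of_nat (Suc m) + 1) * x ^ Suc m + of_nat (Suc m) * x ^ Suc (Suc m)"
    by (simp add: power2_eq_square algebra_simps)
  finally show ?case .
qed simp

text \<open>The remainder is exactly ((m + 1) x^m - m x^(m+1)) / (1 - x)^2. For |x| <= 1/2 the
  numerator is at most (2 m + 1) / 2^m and the denominator at least 1/4.\<close>

lemma inverse_square_taylor_bound:
  fixes x :: complex
  assumes x: "cmod x \<le> 1 / 2"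
  shows "cmod (1 / (1 - x)\<^sup>2 - (\<Sum>l<m. (of_nat l + 1) * x ^ l)) \<le> 4 * (2 * real m + 1) / 2 ^ m"
proof -
  have ge: "1 / 2 \<le> cmod (1 - x)" using norm_triangle_ineq2[of 1 x] x by simp
  hence ne: "1 - x \<noteq> 0" by auto
  have "1 / (1 - x)\<^sup>2 - (\<Sum>l<m. (of_nat l + 1) * x ^ l) =
      (1 - (1 - x)\<^sup>2 * (\<Sum>l<m. (of_nat l + 1) * x ^ l)) / (1 - x)\<^sup>2"
    using ne by (simp add: diff_divide_distrib)
  also have "\<dots> = ((of_nat m + 1) * x ^ m - of_nat m * x ^ Suc m) / (1 - x)\<^sup>2"
    by (simp only: sum_Suc_power_closed_form) simp
  finally have eq: "1 / (1 - x)\<^sup>2 - (\<Sum>l<m. (of_nat l + 1) * x ^ l) =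
      ((of_nat m + 1) * x ^ m - of_nat m * x ^ Suc m) / (1 - x)\<^sup>2" .
  have xm: "cmod x ^ m \<le> (1 / 2) ^ m" by (intro power_mono x) auto
  have "cmod x ^ Suc m \<le> cmod x ^ m" using x by (intro power_decreasing) auto
  hence xm': "cmod x ^ Suc m \<le> (1 / 2) ^ m" using xm by linarith
  have "cmod ((of_nat m + 1) * x ^ m - of_nat m * x ^ Suc m) \<le> cmod ((of_nat m + 1) * x ^ m) + cmod (of_nat m * x ^ Suc m)"
    by (rule norm_triangle_ineq4)
  also have "\<dots> = (real m + 1) * cmod x ^ m + real m * cmod x ^ Suc m"
    by (simp only: norm_mult norm_power norm_of_nat_plus_one norm_of_nat)
  also have "\<dots> \<le> (real m + 1) * (1 / 2) ^ m + real m * (1 / 2) ^ m"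
    by (intro add_mono mult_left_mono xm xm') auto
  finally have num: "cmod ((of_nat m + 1) * x ^ m - of_nat m * x ^ Suc m) \<le> (2 * real m + 1) * (1 / 2) ^ m"
    by (simp add: algebra_simps)
  have den: "(1 / 2)\<^sup>2 \<le> cmod (1 - x) ^ 2" by (intro power_mono ge) auto
  have "cmod (((of_nat m + 1) * x ^ m - of_nat m * x ^ Suc m) / (1 - x)\<^sup>2) \<le> ((2 * real m + 1) * (1 / 2) ^ m) / (1 / 2)\<^sup>2"
    unfolding norm_divide norm_power by (intro frac_le num den) auto
  also have "\<dots> = 4 * (2 * real m + 1) / 2 ^ m" by (simp add: power2_eq_square power_divide)
  finally show ?thesis by (simp only: eq)
qed

text \<open>Write 1 - z * cnj w = P (1 - x) with P the value at w0; the hypothesis says |x| <= 1/2.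
  Expanding (1 - x)^-2 gives powers of \<open>cnj (w - w0)\<close> times functions of z, so the
  polynomial is separable.\<close>

lemma bergman_kernel_taylor_bound:
  assumes ne: "1 - z * cnj w0 \<noteq> 0" and le: "cmod (z * cnj (w - w0)) \<le> cmod (1 - z * cnj w0) / 2"
  shows "cmod (1 / (1 - z * cnj w)\<^sup>2 -
      (\<Sum>l<m. (of_nat l + 1) * z ^ l / (1 - z * cnj w0) ^ (l + 2) * cnj (w - w0) ^ l))
    \<le> 4 * (2 * real m + 1) / 2 ^ m / (cmod (1 - z * cnj w0))\<^sup>2"
proof -
  define P where "P = 1 - z * cnj w0"
  define x where "x = z * cnj (w - w0) / P"
  have P: "P \<noteq> 0" using ne by (simp add: P_def)
  have x: "cmod x \<le> 1 / 2"
    using le P by (simp add: x_def norm_divide P_def[symmetric] divide_le_eq)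
  have "P * (1 - x) = P - P * x" by (simp add: right_diff_distrib)
  also have "P * x = z * cnj (w - w0)" using P by (simp add: x_def)
  also have "P - z * cnj (w - w0) = 1 - z * cnj w" by (simp add: P_def algebra_simps)
  finally have Px: "1 - z * cnj w = P * (1 - x)" by simp
  have summand: "(of_nat l + 1) * z ^ l / P ^ (l + 2) * cnj (w - w0) ^ l = (of_nat l + 1) * x ^ l / P\<^sup>2" for l
    by (simp add: x_def power_divide power_mult_distrib power_add power2_eq_square mult_ac)
  have "1 / (1 - z * cnj w)\<^sup>2 - (\<Sum>l<m. (of_nat l + 1) * z ^ l / P ^ (l + 2) * cnj (w - w0) ^ l) =
      (1 / (1 - x)\<^sup>2 - (\<Sum>l<m. (of_nat l + 1) * x ^ l)) / P\<^sup>2"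
    unfolding Px summand by (simp add: power_mult_distrib diff_divide_distrib sum_divide_distrib mult.commute)
  thus ?thesis
    unfolding P_def[symmetric]
    by (simp only: norm_divide norm_power)
       (intro divide_right_mono inverse_square_taylor_bound x zero_le_power2)
qed

section \<open>Angles, chords and the corners of a sector\<close>

lemma angle0_bounds: "0 \<le> angle0 z" "angle0 z < 2 * pi"
  using Arg_bounded[of z] by (auto simp: angle0_def)

lemma polar_angle0: "z = of_real (cmod z) * cis (angle0 z)"
proof -
  have "cis (angle0 z) = cis (Arg z)"
    by (simp add: angle0_def flip: cis_mult)
  thus ?thesis using rcis_cmod_Arg[of z] by (simp add: rcis_def)
qed

lemma cmod_cis_diff: "cmod (cis s - cis t) = 2 * \<bar>sin ((s - t) / 2)\<bar>"
proof -
  have "(cmod (cis s - cis t))\<^sup>2 = 2 - 2 * cos (s - t)"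
    by (simp add: cmod_power2 power2_diff cos_diff)
       (use sin_cos_squared_add[of s] sin_cos_squared_add[of t] in \<open>simp add: algebra_simps; linarith\<close>)
  also have "\<dots> = (2 * \<bar>sin ((s - t) / 2)\<bar>)\<^sup>2"
  proof -
    have "2 * ((s - t) / 2) = s - t" by simp
    hence "cos (s - t) = 1 - 2 * (sin ((s - t) / 2))\<^sup>2" by (metis cos_double_sin)
    thus ?thesis by (simp add: power_mult_distrib)
  qed
  finally show ?thesis by (rule power2_eq_imp_eq) auto
qed

text \<open>Sine increases up to pi / 2 and is symmetric about it. In the application x is half the
  angle between two points of the circle, and s and t are half the angles from one of them to the
  ends of its arc, met on the direct way and on the way round; the shorter way decides which
  alternative holds.\<close>

lemma sin_mono_or:
  assumes "0 \<le> s" "s \<le> x" "0 \<le> t" "t \<le> pi - x"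
  shows "\<bar>sin s\<bar> \<le> \<bar>sin x\<bar> \<or> \<bar>sin t\<bar> \<le> \<bar>sin x\<bar>"
proof (cases "x \<le> pi / 2")
  case True
  hence "sin s \<le> sin x" using assms by (intro sin_monotone_2pi_le) auto
  moreover have "0 \<le> sin s" using assms True pi_gt_zero by (intro sin_ge_zero) linarith+
  ultimately show ?thesis by simp
next
  case False
  hence "sin t \<le> sin (pi - x)" using assms by (intro sin_monotone_2pi_le) auto
  moreover have "0 \<le> sin t" using assms False pi_gt_zero by (intro sin_ge_zero) linarith+
  ultimately show ?thesis by simp
qed

text \<open>Only the ends of the arc on the unit circle count as corners. The vertex of the sector
  at the origin is harmless, as the kernel is bounded near it.\<close>

definition corner_dist :: "real \<Rightarrow> real \<Rightarrow> complex \<Rightarrow> real" where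
  "corner_dist p q w = min (cmod (w - cis p)) (cmod (w - cis q))"

text \<open>Let D be the modulus on the right and rho = |z| |w|. Then 1 - rho <= D, so the chord
  between the two directions is at most 2 D. An end of the arc lies between them, hence the
  direction of w is within 2 D of a corner. The radial gap 1 - |w| is at most 1 - rho <= D, which
  makes 3 D in total.\<close>

lemma corner_dist_le_bergman_kernel:
  assumes pq: "0 \<le> p" "q \<le> 2 * pi"
    and w: "w \<in> disc" "angle0 w \<in> {p..<q}" and z: "z \<in> disc" "angle0 z \<notin> {p..<q}"
  shows "corner_dist p q w \<le> 3 * cmod (1 - z * cnj w)"
proof -
  define \<alpha> \<beta> where "\<alpha> = angle0 z" and "\<beta> = angle0 w"
  define \<rho> where "\<rho> = cmod z * cmod w"
  have \<beta>: "p \<le> \<beta>" "\<beta> < q" and \<alpha>: "\<alpha> < p \<or> q \<le> \<alpha>" "0 \<le> \<alpha>" "\<alpha> < 2 * pi"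
    using w z angle0_bounds[of z] by (auto simp: \<alpha>_def \<beta>_def)
  have zw: "cmod z < 1" "cmod w < 1" using w z by (auto simp: in_disc_iff)
  have \<rho>: "\<rho> \<le> cmod w" using zw by (simp add: \<rho>_def mult_left_le_one_le)
  have "z * cnj w = (of_real (cmod z) * cis \<alpha>) * cnj (of_real (cmod w) * cis \<beta>)"
    unfolding \<alpha>_def \<beta>_def by (simp flip: polar_angle0)
  hence zeta: "z * cnj w = of_real \<rho> * cis (\<alpha> - \<beta>)"
    by (simp add: \<rho>_def cis_cnj) (simp add: cis_mult)
  let ?D = "cmod (1 - z * cnj w)"
  have "cmod (z * cnj w) = \<rho>" by (simp add: \<rho>_def norm_mult)
  hence D1: "1 - \<rho> \<le> ?D" using norm_triangle_ineq2[of 1 "z * cnj w"] by simp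
  have "cmod (cis \<alpha> - cis \<beta>) = cmod (cis (\<alpha> - \<beta>) - cis 0)"
    by (simp only: cmod_cis_diff) simp
  also have "\<dots> \<le> cmod (cis (\<alpha> - \<beta>) - z * cnj w) + cmod (z * cnj w - cis 0)"
    using norm_triangle_ineq[of "cis (\<alpha> - \<beta>) - z * cnj w" "z * cnj w - cis 0"] by simp
  also have "cis (\<alpha> - \<beta>) - z * cnj w = of_real (1 - \<rho>) * cis (\<alpha> - \<beta>)"
    by (simp add: zeta algebra_simps)
  also have "cmod \<dots> = 1 - \<rho>" using \<rho> zw by (simp add: norm_mult del: of_real_diff)
  also have "cmod (z * cnj w - cis 0) = ?D" by (simp add: norm_minus_commute)
  finally have D2: "cmod (cis \<alpha> - cis \<beta>) \<le> 2 * ?D" using D1 by linarith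
  have "cmod (cis \<beta> - cis p) \<le> cmod (cis \<alpha> - cis \<beta>) \<or> cmod (cis \<beta> - cis q) \<le> cmod (cis \<alpha> - cis \<beta>)"
  proof (cases "q \<le> \<alpha>")
    case True
    have "\<bar>sin ((q - \<beta>) / 2)\<bar> \<le> \<bar>sin ((\<alpha> - \<beta>) / 2)\<bar> \<or> \<bar>sin ((\<beta> - p) / 2)\<bar> \<le> \<bar>sin ((\<alpha> - \<beta>) / 2)\<bar>"
      by (rule sin_mono_or) (use True \<alpha> \<beta> pq in \<open>auto simp: field_simps\<close>)
    thus ?thesis using norm_minus_commute[of "cis \<beta>" "cis q"] by (auto simp: cmod_cis_diff)
  next
    case False
    hence "\<alpha> < p" using \<alpha> by auto
    hence "\<bar>sin ((\<beta> - p) / 2)\<bar> \<le> \<bar>sin ((\<beta> - \<alpha>) / 2)\<bar> \<or> \<bar>sin ((q - \<beta>) / 2)\<bar> \<le> \<bar>sin ((\<beta> - \<alpha>) / 2)\<bar>"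
      by (intro sin_mono_or) (use \<alpha> \<beta> pq in \<open>auto simp: field_simps\<close>)
    thus ?thesis
      using norm_minus_commute[of "cis \<beta>" "cis q"] norm_minus_commute[of "cis \<beta>" "cis \<alpha>"]
      by (auto simp: cmod_cis_diff)
  qed
  moreover have "cmod (w - cis t) \<le> ?D + cmod (cis \<beta> - cis t)" for t
  proof -
    have "w - cis \<beta> = of_real (cmod w - 1) * cis \<beta>"
      using polar_angle0[of w] by (simp add: \<beta>_def algebra_simps)
    hence "cmod (w - cis \<beta>) = 1 - cmod w" using zw by (simp add: norm_mult del: of_real_diff)
    thus ?thesis
      using norm_triangle_ineq[of "w - cis \<beta>" "cis \<beta> - cis t"] D1 \<rho> by simp
  qed
  ultimately show ?thesis
    using D2 unfolding corner_dist_def by (smt (verit, best))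
qed

text \<open>This turns closeness to a corner into closeness to the circle, where \<open>phi0\<close>
  is small.\<close>

lemma corner_dist_ge: "1 - cmod w \<le> corner_dist p q w"
  using norm_triangle_ineq2[of "cis p" w] norm_triangle_ineq2[of "cis q" w]
  by (simp add: corner_dist_def norm_minus_commute)

lemma corner_dist_measurable [measurable]: "corner_dist p q \<in> borel_measurable borel"
  unfolding corner_dist_def[abs_def] by measurable

text \<open>Scaling by 2^i / 2 around a corner maps the shell at distance about 2^-i into the unit
  disc, which a fixed finite family of small balls covers. Two corners, n + 1 shells and this family
  give the linear count, with M independent of n, p, q and S. The centres are picked from S itself,
  because the kernel estimate is later applied at the centres.\<close>

lemma dyadic_corner_cover:
  "\<exists>M. \<forall>n p q. \<forall>S \<subseteq> {w \<in> disc. (1 / 2) ^ n \<le> corner_dist p q w}. \<exists>W \<subseteq> S. finite W \<and>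
     card W \<le> M * (n + 1) \<and> (\<forall>w\<in>S. \<exists>w0\<in>W. cmod (w - w0) \<le> corner_dist p q w0 / 6)"
proof -
  \<comment> \<open>Two points in one ball of radius 1/24 are within 1/12, which is 2^-i / 6 after
    undoing the scaling. The factor 1/6 combines with the constant 3 of
    \<open>corner_dist_le_bergman_kernel\<close> to the ratio 1/2 needed for the Taylor
    expansion.\<close>
  have "cball (0::complex) 1 \<subseteq> (\<Union>y. ball y (1 / 24))"
  proof
    fix x :: complex
    show "x \<in> (\<Union>y. ball y (1 / 24))" by (rule UN_I[of x]) auto
  qed
  then obtain F where F: "finite F" "cball (0::complex) 1 \<subseteq> (\<Union>y\<in>F. ball y (1 / 24))"
    using compactE_image[OF compact_cball, of UNIV "\<lambda>y. ball y (1 / 24)" "0::complex" 1] by auto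
  show ?thesis
  proof (intro exI[of _ "2 * card F"] allI impI)
    fix n p q S assume S: "S \<subseteq> {w \<in> disc. (1 / 2) ^ n \<le> corner_dist p q w}"
    let ?d = "corner_dist p q"
    \<comment> \<open>A cell is labelled by the nearer corner, the dyadic shell and the small ball
      containing the rescaled point.\<close>
    define cell where "cell = (\<lambda>(c, i, y). {w \<in> S. cmod (w - c) = ?d w \<and> (1 / 2) ^ i \<le> ?d w \<and>
        (2 ^ i / 2) * (w - c) \<in> ball y (1 / 24)})"
    let ?J = "{cis p, cis q} \<times> {..n} \<times> F"
    define pt where "pt j = (SOME w. w \<in> cell j)" for j
    define W where "W = pt ` {j \<in> ?J. cell j \<noteq> {}}"
    have J: "finite ?J" using F by simp
    have pt: "pt j \<in> cell j" if "cell j \<noteq> {}" for j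
      using that unfolding pt_def by (metis some_in_eq)
    have WS: "W \<subseteq> S" using pt by (fastforce simp: W_def cell_def split: prod.splits)
    have "card W \<le> card {j \<in> ?J. cell j \<noteq> {}}" unfolding W_def by (rule card_image_le) (use J in auto)
    also have "\<dots> \<le> card ?J" by (rule card_mono) (use J in auto)
    also have "\<dots> = card {cis p, cis q} * ((n + 1) * card F)"
      by (simp add: card_cartesian_product)
    also have "\<dots> \<le> 2 * ((n + 1) * card F)" by (intro mult_right_mono) (auto simp: card_insert_if)
    finally have card: "card W \<le> 2 * card F * (n + 1)" by (simp add: mult_ac)
    have cover: "\<exists>w0\<in>W. cmod (w - w0) \<le> ?d w0 / 6" if w: "w \<in> S" for w
    proof -
      have dn: "(1 / 2) ^ n \<le> ?d w" and wd: "cmod w < 1" using w S by (auto simp: in_disc_iff)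
      define i where "i = (LEAST i. (1 / 2) ^ i \<le> ?d w)"
      have i1: "(1 / 2) ^ i \<le> ?d w" unfolding i_def by (rule LeastI[of _ n]) (rule dn)
      have i2: "i \<le> n" unfolding i_def by (rule Least_le) (rule dn)
      \<comment> \<open>For i > 0 this is minimality of i; for i = 0 it holds because points of the
        disc have distance at most 2 from the circle's points.\<close>
      have i3: "?d w \<le> 2 * (1 / 2) ^ i"
      proof (cases i)
        case 0
        have "?d w \<le> cmod (w - cis p)" by (simp add: corner_dist_def)
        also have "\<dots> \<le> cmod w + cmod (cis p)" by (rule norm_triangle_ineq4)
        finally show ?thesis using wd 0 by simp
      next
        case (Suc k)
        have "\<not> (1 / 2) ^ k \<le> ?d w" by (rule not_less_Least) (simp add: Suc flip: i_def)
        thus ?thesis by (simp add: Suc)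
      qed
      have "cmod (w - cis p) = ?d w \<or> cmod (w - cis q) = ?d w"
        by (auto simp: corner_dist_def min_def)
      then obtain c where c: "c \<in> {cis p, cis q}" "cmod (w - c) = ?d w"
        by blast
      have "cmod ((2 ^ i / 2) * (w - c)) = 2 ^ i / 2 * ?d w" by (simp add: norm_mult norm_divide norm_power c)
      also have "\<dots> \<le> 2 ^ i / 2 * (2 * (1 / 2) ^ i)" by (intro mult_left_mono i3) auto
      also have "\<dots> = 1" by (simp add: power_divide)
      finally have "(2 ^ i / 2) * (w - c) \<in> cball 0 1" by simp
      then obtain y where y: "y \<in> F" "(2 ^ i / 2) * (w - c) \<in> ball y (1 / 24)" using F by blast
      let ?j = "(c, i, y)"
      have wj: "w \<in> cell ?j" using w c i1 y by (simp add: cell_def)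
      have jJ: "?j \<in> ?J" using c i2 y by auto
      define w0 where "w0 = pt ?j"
      have w0W: "w0 \<in> W" unfolding W_def w0_def using wj jJ by blast
      have w0: "w0 \<in> cell ?j" unfolding w0_def by (rule pt) (use wj in blast)
      have "(2 ^ i / 2) * (w - w0) = (2 ^ i / 2) * (w - c) - (2 ^ i / 2) * (w0 - c)"
        by (simp add: right_diff_distrib diff_divide_distrib)
      hence "cmod ((2 ^ i / 2) * (w - w0)) = dist ((2 ^ i / 2) * (w - c)) ((2 ^ i / 2) * (w0 - c))"
        by (simp only: dist_norm)
      also have "\<dots> \<le> dist y ((2 ^ i / 2) * (w - c)) + dist y ((2 ^ i / 2) * (w0 - c))"
        by (rule dist_triangle3)
      also have "\<dots> \<le> 1 / 12" using wj w0 by (simp add: cell_def)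
      finally have "2 ^ i / 2 * cmod (w - w0) \<le> 1 / 12" by (simp add: norm_mult norm_divide norm_power)
      hence "cmod (w - w0) \<le> (1 / 2) ^ i / 6" by (simp add: field_simps power_divide)
      also have "\<dots> \<le> ?d w0 / 6" using w0 by (simp add: cell_def)
      finally show ?thesis using w0W by blast
    qed
    show "\<exists>W\<subseteq>S. finite W \<and> card W \<le> 2 * card F * (n + 1) \<and> (\<forall>w\<in>S. \<exists>w0\<in>W. cmod (w - w0) \<le> ?d w0 / 6)"
      using WS card cover J unfolding W_def by (intro exI[of _ W]) (auto simp: W_def)
  qed
qed

section \<open>Products of Toeplitz operators on disjoint sectors\<close>

text \<open>M is obtained before n, p, q and the symbols, since the truncated symbol v will change
  with n. The index set consists of pairs of a covering disc and a Taylor exponent, which accounts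
  for the rank.\<close>

lemma separated_symbols_low_rank:
  obtains M where "\<And>n p q u v. 0 \<le> p \<Longrightarrow> q \<le> 2 * pi \<Longrightarrow>
     u \<in> borel_measurable borel \<Longrightarrow> (\<And>z. z \<in> disc \<Longrightarrow> cmod (u z) \<le> 1) \<Longrightarrow>
     v \<in> borel_measurable borel \<Longrightarrow> (\<And>z. z \<in> disc \<Longrightarrow> cmod (v z) \<le> 1) \<Longrightarrow>
     (\<And>z. z \<in> disc \<Longrightarrow> u z \<noteq> 0 \<Longrightarrow> angle0 z \<notin> {p..<q}) \<Longrightarrow>
     (\<And>w. w \<in> disc \<Longrightarrow> v w \<noteq> 0 \<Longrightarrow> angle0 w \<in> {p..<q} \<and> (1 / 2) ^ n \<le> corner_dist p q w) \<Longrightarrow>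
     low_rank_approximable (M * (n + 1) * (4 * n)) (36 * (8 * real n + 1) / 4 ^ n) (toeplitz_product u v)"
proof -
  obtain M where M: "\<And>n p q S. S \<subseteq> {w \<in> disc. (1 / 2) ^ n \<le> corner_dist p q w} \<Longrightarrow> \<exists>W \<subseteq> S. finite W \<and>
     card W \<le> M * (n + 1) \<and> (\<forall>w\<in>S. \<exists>w0\<in>W. cmod (w - w0) \<le> corner_dist p q w0 / 6)"
    using dyadic_corner_cover by blast
  show thesis
  proof (rule that[of M])
    fix n :: nat and p q :: real and u v :: "complex \<Rightarrow> complex"
    assume pq: "0 \<le> p" "q \<le> 2 * pi"
      and u: "u \<in> borel_measurable borel" "\<And>z. z \<in> disc \<Longrightarrow> cmod (u z) \<le> 1"
      and v: "v \<in> borel_measurable borel" "\<And>z. z \<in> disc \<Longrightarrow> cmod (v z) \<le> 1"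
      and u0: "\<And>z. z \<in> disc \<Longrightarrow> u z \<noteq> 0 \<Longrightarrow> angle0 z \<notin> {p..<q}"
      and v0: "\<And>w. w \<in> disc \<Longrightarrow> v w \<noteq> 0 \<Longrightarrow> angle0 w \<in> {p..<q} \<and> (1 / 2) ^ n \<le> corner_dist p q w"
    note [measurable] = u(1) v(1)
    define S where "S = {w \<in> disc. angle0 w \<in> {p..<q} \<and> (1 / 2) ^ n \<le> corner_dist p q w}"
    have "S \<subseteq> {w \<in> disc. (1 / 2) ^ n \<le> corner_dist p q w}" by (auto simp: S_def)
    from M[OF this] obtain W where W: "W \<subseteq> S" "finite W" "card W \<le> M * (n + 1)"
      and cover: "\<forall>w\<in>S. \<exists>w0\<in>W. cmod (w - w0) \<le> corner_dist p q w0 / 6" by blast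
    define k where "k = card W"
    obtain e where e: "bij_betw e {..<k} W"
      using ex_bij_betw_nat_finite[OF W(2)] by (auto simp: atLeast0LessThan k_def)
    have eS: "e i \<in> S" if "i < k" for i using bij_betwE[OF e] that W(1) by auto
    define near where "near i w \<longleftrightarrow> cmod (w - e i) \<le> corner_dist p q (e i) / 6" for i w
    \<comment> \<open>Assigning w to the first disc that contains it makes the overlapping discs
      disjoint, so that exactly one Taylor polynomial is active in the sum.\<close>
    define first where "first i w \<longleftrightarrow> near i w \<and> (\<forall>j<i. \<not> near j w)" for i w
    \<comment> \<open>The remainder contributes 2^-m = 16^-n, while 1 / |P|^2 can be as large as 9 *
      4^n; their product still decays like 4^-n, up to the linear factor.\<close>
    define m where "m = 4 * n"
    define I where "I = {..<k} \<times> {..<m}"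
    define a where "a = (\<lambda>(i, l) z. (of_nat l + 1) * z ^ l / (1 - z * cnj (e i)) ^ (l + 2))"
    define b where "b = (\<lambda>(i, l) w. if first i w then cnj (w - e i) ^ l else 0)"
    have near_measurable [measurable]: "Measurable.pred borel (near i)" for i
      unfolding near_def[abs_def] by measurable
    have first_measurable [measurable]: "Measurable.pred borel (first i)" for i
      unfolding first_def[abs_def] by measurable
    have "low_rank_approximable (card I) (36 * (8 * real n + 1) / 4 ^ n) (toeplitz_product u v)"
    \<comment> \<open>The bound 2^l comes from the diameter of the unit disc.\<close>
    proof (rule separable_kernel_approximation[where a = a and b = b and \<beta> = "\<lambda>(i, l). 2 ^ l"])
      show "finite I" by (simp add: I_def)
      fix j assume j: "j \<in> I"
      then obtain i l where il: "j = (i, l)" "i < k" "l < m" by (auto simp: I_def)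
      have ei: "cmod (e i) < 1" using eS[OF il(2)] by (simp add: S_def in_disc_iff)
      have ge: "1 - cmod (e i) \<le> cmod (1 - z * cnj (e i))" if "z \<in> disc" for z
      proof -
        have "cmod z * cmod (e i) \<le> 1 * cmod (e i)"
          using that by (intro mult_right_mono) (auto simp: in_disc_iff)
        thus ?thesis using norm_triangle_ineq2[of 1 "z * cnj (e i)"] by (simp add: norm_mult)
      qed
      have "cmod (a j z) \<le> (real l + 1) / (1 - cmod (e i)) ^ (l + 2)" if z: "z \<in> disc" for z
      proof -
        have "cmod z ^ l \<le> 1" using z by (intro power_le_one) (auto simp: in_disc_iff)
        hence "(real l + 1) * cmod z ^ l \<le> (real l + 1) * 1" by (intro mult_left_mono) auto
        moreover have "(1 - cmod (e i)) ^ (l + 2) \<le> cmod (1 - z * cnj (e i)) ^ (l + 2)"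
          using ei by (intro power_mono ge z) auto
        ultimately show ?thesis
          unfolding a_def il prod.case norm_divide norm_mult norm_power norm_of_nat_plus_one
          using ei by (intro frac_le) auto
      qed
      moreover have am: "a j \<in> borel_measurable borel" unfolding a_def il prod.case by measurable
      ultimately have "a j \<in> L2D" by (intro L2D_bounded)
      thus "(\<lambda>z. u z * a j z) \<in> L2D" using u by (intro L2D_mult_bounded[where B = 1]) auto
      show "b j \<in> borel_measurable borel" unfolding b_def il prod.case by measurable
      show "cmod (b j w) \<le> (case j of (i, l) \<Rightarrow> 2 ^ l)" if w: "w \<in> disc" for w
      proof -
        have "cmod (w - e i) \<le> 2" using norm_triangle_ineq4[of w "e i"] w ei by (simp add: in_disc_iff)
        hence "cmod (w - e i) ^ l \<le> 2 ^ l" by (intro power_mono) auto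
        moreover have "cmod (cnj (w - e i) ^ l) = cmod (w - e i) ^ l"
          by (simp only: norm_power complex_mod_cnj)
        ultimately show ?thesis by (simp add: b_def il del: complex_cnj_diff)
      qed
    next
      fix z w assume z: "z \<in> disc" "u z \<noteq> 0" and w: "w \<in> disc" "v w \<noteq> 0"
      have wS: "w \<in> S" using v0 w by (simp add: S_def)
      then obtain w0 where "w0 \<in> W" "cmod (w - w0) \<le> corner_dist p q w0 / 6" using cover by blast
      then obtain i0 where i0: "i0 < k" "near i0 w"
        using bij_betw_imp_surj_on[OF e] by (auto simp: near_def)
      define i where "i = (LEAST i. near i w)"
      have near_i: "near i w" unfolding i_def by (rule LeastI) (rule i0(2))
      have "i \<le> i0" unfolding i_def by (rule Least_le) (rule i0(2))
      hence ik: "i < k" using i0 by simp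
      have first_iff: "first j w \<longleftrightarrow> j = i" for j
      proof
        assume f: "first j w"
        hence "i \<le> j" unfolding first_def i_def by (intro Least_le) auto
        moreover have "\<not> i < j" using f near_i by (auto simp: first_def)
        ultimately show "j = i" by simp
      next
        assume "j = i"
        moreover have "\<not> near j' w" if "j' < i" for j'
          using that unfolding i_def by (rule not_less_Least)
        ultimately show "first j w" using near_i by (simp add: first_def)
      qed
      have "(\<Sum>j\<in>I. a j z * b j w) = (\<Sum>i'<k. \<Sum>l<m. a (i', l) z * b (i', l) w)"
        by (simp add: I_def sum.cartesian_product)
      also have "\<dots> = (\<Sum>i'<k. if i' = i then (\<Sum>l<m. a (i, l) z * cnj (w - e i) ^ l) else 0)"
        by (intro sum.cong refl) (auto simp: b_def first_iff)
      also have "\<dots> = (\<Sum>l<m. a (i, l) z * cnj (w - e i) ^ l)" using ik by simp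
      finally have sum: "(\<Sum>j\<in>I. a j z * b j w) =
          (\<Sum>l<m. (of_nat l + 1) * z ^ l / (1 - z * cnj (e i)) ^ (l + 2) * cnj (w - e i) ^ l)"
        by (simp add: a_def)
      let ?P = "1 - z * cnj (e i)"
      have eiS: "e i \<in> disc" "angle0 (e i) \<in> {p..<q}" "(1 / 2) ^ n \<le> corner_dist p q (e i)"
        using eS[OF ik] by (auto simp: S_def)
      have dP: "corner_dist p q (e i) \<le> 3 * cmod ?P"
        by (rule corner_dist_le_bergman_kernel[OF pq eiS(1,2) z(1)]) (use u0 z in auto)
      have ne: "?P \<noteq> 0" by (rule one_minus_mult_cnj_ne_0[OF z(1) eiS(1)])
      have "cmod (z * cnj (w - e i)) \<le> 1 * cmod (w - e i)"
        unfolding norm_mult complex_mod_cnj using z by (intro mult_right_mono) (auto simp: in_disc_iff)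
      also have "\<dots> \<le> corner_dist p q (e i) / 6" using near_i by (simp add: near_def)
      also have "\<dots> \<le> cmod ?P / 2" using dP by simp
      finally have le: "cmod (z * cnj (w - e i)) \<le> cmod ?P / 2" .
      have "(1 / 2) ^ n / 3 \<le> cmod ?P" using dP eiS(3) by simp
      hence "((1 / 2) ^ n / 3)\<^sup>2 \<le> (cmod ?P)\<^sup>2" by (intro power_mono) auto
      hence "4 * (2 * real m + 1) / 2 ^ m / (cmod ?P)\<^sup>2 \<le> 4 * (2 * real m + 1) / 2 ^ m / ((1 / 2) ^ n / 3)\<^sup>2"
        using ne by (intro divide_left_mono mult_pos_pos) auto
      also have "\<dots> = 36 * (8 * real n + 1) / 4 ^ n"
      proof -
        have "(2::real) ^ m = 4 ^ n * 4 ^ n"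
          by (simp add: m_def power_mult flip: power_mult_distrib)
        moreover have "((1 / 2) ^ n / 3)\<^sup>2 = 1 / (9 * (4::real) ^ n)"
          by (simp add: power_divide power2_eq_square flip: power_mult_distrib)
        ultimately show ?thesis by (simp add: m_def field_simps)
      qed
      finally show "cmod (1 / (1 - z * cnj w)\<^sup>2 - (\<Sum>j\<in>I. a j z * b j w)) \<le> 36 * (8 * real n + 1) / 4 ^ n"
        using bergman_kernel_taylor_bound[OF ne le, of m] unfolding sum by linarith
    qed (use u v in auto)
    moreover have "card I \<le> M * (n + 1) * (4 * n)"
      using W(3) by (simp add: I_def m_def k_def)
    ultimately show "low_rank_approximable (M * (n + 1) * (4 * n)) (36 * (8 * real n + 1) / 4 ^ n) (toeplitz_product u v)"
      unfolding low_rank_approximable_def using order_trans by blast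
  qed
qed

section \<open>Measurability and size of the symbols\<close>

lemma angle0_measurable [measurable]: "angle0 \<in> borel_measurable borel"
proof -
  have eq: "Arg = (\<lambda>z. if z = 0 then 0 else Im (Ln z))" by (auto simp: Arg_eq_Im_Ln Arg_zero)
  have [measurable]: "Arg \<in> borel_measurable borel" unfolding eq by measurable
  show ?thesis unfolding angle0_def[abs_def] by measurable
qed

lemma chi_tilde_measurable [measurable]: "chi_tilde \<gamma> L j \<in> borel_measurable borel"
  unfolding chi_tilde_def[abs_def] phi0_def by measurable

text \<open>Monotonicity in the distance to the circle. It is used with x = 1 for the bound by 1,
  and with x = 2^-n for the decay near the corners.\<close>

lemma phi0_le:
  assumes "\<gamma> > 0" "0 < x" "x \<le> 1" "0 \<le> r" "1 - r \<le> x" "r < 1"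
  shows "0 \<le> phi0 \<gamma> r" "phi0 \<gamma> r \<le> (1 + ln (1 / x)) powr (- \<gamma>)"
proof -
  show "0 \<le> phi0 \<gamma> r" by (simp add: phi0_def)
  have "ln (1 / x) \<le> ln (1 / (1 - r))" using assms by (subst ln_le_cancel_iff) (auto simp: frac_le)
  moreover have "0 \<le> ln (1 / x)" using assms by simp
  hence "0 < 1 + ln (1 / x)" by linarith
  ultimately show "phi0 \<gamma> r \<le> (1 + ln (1 / x)) powr (- \<gamma>)"
    unfolding phi0_def using assms(1) by (intro powr_mono2') linarith+
qed

lemma chi_tilde_bounded:
  assumes "\<gamma> > 0"
  shows "cmod (chi_tilde \<gamma> L j z) \<le> 1"
  using phi0_le[OF assms, of 1 "cmod z"] by (auto simp: chi_tilde_def in_disc_iff)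

text \<open>Given N, choose n of order sqrt N so that the rank stays below N. The logarithmic term
  dominates \<open>\<delta> n\<close>, which is thus of order n^-gamma, and the singular values
  decay like a power of N.\<close>

lemma Sigma0_if_low_rank_approximation:
  fixes M :: nat and \<gamma> :: real
  assumes \<gamma>: "\<gamma> > 0" and T: "linear_on_bergman T" "bounded_on_bergman T"
    and approx: "\<And>n. low_rank_approximable (M * (n + 1) * (4 * n)) (\<delta> n) T"
    and \<delta>: "\<And>n. \<delta> n = (1 + real n * ln 2) powr (- \<gamma>) + 36 * (8 * real n + 1) / 4 ^ n"
  shows "Sigma0 (2 * \<gamma>) T"
proof -
  have \<delta>_eq: "\<delta> = (\<lambda>n. (1 + real n * ln 2) powr (- \<gamma>) + 36 * (8 * real n + 1) / 4 ^ n)"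
    by (simp add: \<delta> fun_eq_iff)
  have \<delta>_nonneg: "0 \<le> \<delta> n" for n by (simp add: \<delta>)
  have lim: "\<delta> \<longlonglongrightarrow> 0" unfolding \<delta>_eq using \<gamma> by real_asymp
  have big: "\<delta> \<in> O(\<lambda>n. (real n + 1) powr (- \<gamma>))" unfolding \<delta>_eq using \<gamma> by real_asymp
  \<comment> \<open>For n >= 1 the rank bound is at most 8 M n^2; the extra 1 keeps the divisor
    positive when M = 0.\<close>
  define D where "D = real (8 * M + 1)"
  have D: "D \<ge> 1" by (simp add: D_def)
  define h where "h N = nat \<lfloor>sqrt (real N / D)\<rfloor>" for N
  have h1: "real (h N) \<le> sqrt (real N / D)" for N
    using D by (simp add: h_def)
  have h2: "sqrt (real N / D) \<le> real (h N) + 1" for N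
    unfolding h_def by linarith
  have h_lim: "filterlim h at_top sequentially"
  proof -
    have "filterlim (\<lambda>N. real (h N)) at_top sequentially"
    proof (rule filterlim_at_top_mono)
      show "filterlim (\<lambda>N. sqrt (real N / D) - 1) at_top sequentially" using D by real_asymp
      show "eventually (\<lambda>N. sqrt (real N / D) - 1 \<le> real (h N)) sequentially"
        using h2 by (intro always_eventually allI) (simp add: algebra_simps)
    qed
    thus ?thesis by (simp add: filterlim_sequentially_iff_filterlim_real)
  qed
  have rank: "M * (h N + 1) * (4 * h N) \<le> N" for N
  proof -
    have "real (h N) ^ 2 \<le> sqrt (real N / D) ^ 2" by (intro power_mono h1) auto
    hence hD: "D * real (h N) ^ 2 \<le> real N" using D by (simp add: field_simps)
    have "M * (n + 1) * (4 * n) \<le> (8 * M + 1) * n ^ 2" for n :: nat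
    proof (cases n)
      case (Suc k)
      hence "n + 1 \<le> 2 * n" by simp
      hence "M * (n + 1) * (4 * n) \<le> M * (2 * n) * (4 * n)" by (intro mult_mono) auto
      also have "\<dots> \<le> (8 * M + 1) * n ^ 2" by (simp add: power2_eq_square)
      finally show ?thesis .
    qed simp
    hence "M * (h N + 1) * (4 * h N) \<le> (8 * M + 1) * (h N) ^ 2" by blast
    hence "real (M * (h N + 1) * (4 * h N)) \<le> D * real (h N) ^ 2" unfolding D_def of_nat_power[symmetric] of_nat_mult[symmetric] of_nat_le_iff .
    thus ?thesis using hD by linarith
  qed
  have s: "sing_val N T \<le> \<delta> (h N)" for N
    by (rule sing_val_le[OF T approx rank \<delta>_nonneg])
  have "(\<lambda>N. sing_val N T) \<in> O(\<lambda>N. \<delta> (h N))"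
    using s sing_val_nonneg[OF T] by (intro bigoI[where c = 1] always_eventually allI) (simp add: abs_of_nonneg \<delta>_nonneg)
  also have "(\<lambda>N. \<delta> (h N)) \<in> O(\<lambda>N. (real (h N) + 1) powr (- \<gamma>))"
    by (rule landau_o.big.compose[OF big h_lim])
  \<comment> \<open>Rounding down costs less than 1, so h N + 1 is at least sqrt (N / D), and the
    negative exponent reverses the inequality.\<close>
  also have "(\<lambda>N. (real (h N) + 1) powr (- \<gamma>)) \<in> O(\<lambda>N. sqrt (real N / D) powr (- \<gamma>))"
  proof (rule bigoI[where c = 1])
    show "eventually (\<lambda>N. norm ((real (h N) + 1) powr (- \<gamma>)) \<le> 1 * norm (sqrt (real N / D) powr (- \<gamma>))) sequentially"
      using eventually_gt_at_top[of 0]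
    proof eventually_elim
      case (elim N)
      have "(real (h N) + 1) powr (- \<gamma>) \<le> sqrt (real N / D) powr (- \<gamma>)"
        by (rule powr_mono2') (use \<gamma> elim D h2[of N] in auto)
      thus ?case by simp
    qed
  qed
  also have "(\<lambda>N. sqrt (real N / D) powr (- \<gamma>)) \<in> o(\<lambda>N. ln (real N + 1) powr (- (2 * \<gamma>)))"
    using D \<gamma> by real_asymp
  finally have "(\<lambda>N. sing_val N T) \<in> o(\<lambda>N. ln (real N + 1) powr (- (2 * \<gamma>)))" .
  thus ?thesis
    unfolding Sigma0_def using compact_op_if_approximable[OF T(1) approx lim] by blast
qed

text \<open>T has to agree with the product only on \<open>bergman\<close>, which lets one statement
  serve both compositions with an adjoint. The inner symbol is the one that is split: its part near
  the corners is small, its part away from them has low rank.\<close>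

lemma toeplitz_chi_tilde_product_Sigma0:
  fixes \<gamma> :: real and L j k :: nat
  assumes \<gamma>: "\<gamma> > 0" and L: "L \<ge> 1" and j: "j \<in> {1..L}" and jk: "j \<noteq> k" and k: "k \<in> {1..L}"
    and T: "\<And>f. f \<in> bergman \<Longrightarrow> T f = toeplitz (chi_tilde \<gamma> L k) (toeplitz (chi_tilde \<gamma> L j) f)"
  shows "Sigma0 (2 * \<gamma>) T"
proof -
  define u v where "u = chi_tilde \<gamma> L k" and "v = chi_tilde \<gamma> L j"
  have m [measurable]: "u \<in> borel_measurable borel" "v \<in> borel_measurable borel" by (simp_all add: u_def v_def)
  have b: "cmod (u z) \<le> 1" "cmod (v z) \<le> 1" for z
    using chi_tilde_bounded[OF \<gamma>] by (simp_all add: u_def v_def)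
  have wL: "(\<lambda>z. w z * f z) \<in> L2D" if "w \<in> borel_measurable borel" "\<And>z. cmod (w z) \<le> 1" "f \<in> L2D" for w f
    using that by (intro L2D_mult_bounded[where B = 1]) auto
  have wB: "bergman_integral (\<lambda>z. w z * f z) \<in> bergman"
    if "w \<in> borel_measurable borel" "\<And>z. cmod (w z) \<le> 1" "f \<in> L2D" for w f
    by (intro bergman_integral_bergman wL that)
  have w_le: "l2_norm (bergman_integral (\<lambda>z. w z * f z)) \<le> c * l2_norm f"
    if w: "w \<in> borel_measurable borel" "\<And>z. cmod (w z) \<le> 1" and f: "f \<in> L2D"
      and c: "\<And>z. z \<in> disc \<Longrightarrow> cmod (w z) \<le> c" for w f c
    using l2_norm_bergman_integral_le[OF wL[OF w f]] l2_norm_mult_le[OF f w(1) c] by linarith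
  let ?A = "toeplitz_product u"
  have TA: "T f = ?A v f" if f: "f \<in> bergman" for f
    unfolding T[OF f] toeplitz_product_def u_def[symmetric] v_def[symmetric]
    using toeplitz_eq[OF f m(2) b(2)] toeplitz_eq[OF wB[OF m(2) b(2) bergman_L2D[OF f]] m(1) b(1)]
    by simp
  have product_bergman: "?A w f \<in> bergman" if "w \<in> borel_measurable borel" "\<And>z. cmod (w z) \<le> 1" "f \<in> L2D" for w f
    unfolding toeplitz_product_def by (intro wB m b bergman_L2D that)
  have product_le: "l2_norm (?A w f) \<le> c * l2_norm f"
    if w: "w \<in> borel_measurable borel" "\<And>z. cmod (w z) \<le> 1" and f: "f \<in> L2D"
      and c: "\<And>z. z \<in> disc \<Longrightarrow> cmod (w z) \<le> c" for w f c
    unfolding toeplitz_product_def using w_le[OF m(1) b(1) bergman_L2D[OF wB[OF w f]], of 1] w_le[OF w f c] b(1) by fastforce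
  have linear: "linear_on_bergman T"
    unfolding linear_on_bergman_def
  proof (intro conjI ballI allI)
    fix f assume f: "f \<in> bergman"
    show "T f \<in> bergman" unfolding TA[OF f] by (intro product_bergman m b bergman_L2D f)
  next
    fix f g \<alpha> \<beta> assume fg: "f \<in> bergman" "g \<in> bergman"
    note L = wL[OF m(2) b(2) bergman_L2D]
    note B = bergman_integral_bergman[OF L]
    have "bergman_integral (\<lambda>z. v z * (\<alpha> * f z + \<beta> * g z)) =
        bergman_integral (\<lambda>z. \<alpha> * (v z * f z) + \<beta> * (v z * g z))"
      by (simp add: algebra_simps)
    also have "\<dots> = (\<lambda>z. \<alpha> * bergman_integral (\<lambda>z. v z * f z) z + \<beta> * bergman_integral (\<lambda>z. v z * g z) z)"
      by (intro bergman_integral_lincomb L fg)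
    finally have "?A v (\<lambda>z. \<alpha> * f z + \<beta> * g z) = bergman_integral (\<lambda>z.
        \<alpha> * (u z * bergman_integral (\<lambda>z. v z * f z) z) + \<beta> * (u z * bergman_integral (\<lambda>z. v z * g z) z))"
      by (simp add: toeplitz_product_def algebra_simps)
    also have "\<dots> = (\<lambda>z. \<alpha> * ?A v f z + \<beta> * ?A v g z)"
      unfolding toeplitz_product_def by (intro bergman_integral_lincomb wL m b bergman_L2D B fg)
    finally show "T (\<lambda>z. \<alpha> * f z + \<beta> * g z) = (\<lambda>z. \<alpha> * T f z + \<beta> * T g z)"
      using fg by (simp add: TA bergman_lincomb)
  qed
  have bounded: "bounded_on_bergman T"
    unfolding bounded_on_bergman_def
  proof (intro exI[of _ 1] ballI)
    fix f assume f: "f \<in> bergman"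
    show "l2_norm (T f) \<le> 1 * l2_norm f" unfolding TA[OF f] by (intro product_le m b bergman_L2D f)
  qed
  define p q where "p = 2 * pi * (real j - 1) / real L" and "q = 2 * pi * real j / real L"
  have pq: "0 \<le> p" "q \<le> 2 * pi" using j L by (auto simp: p_def q_def field_simps)
  have v0: "angle0 z \<in> {p..<q}" if "v z \<noteq> 0" for z
    using that by (auto simp: v_def chi_tilde_def p_def q_def split: if_splits)
  \<comment> \<open>Half-open sectors with different indices are disjoint: the end of the one with
    the smaller index is at most the start of the other.\<close>
  have u0: "angle0 z \<notin> {p..<q}" if "u z \<noteq> 0" for z
  proof -
    have z: "2 * pi * (real k - 1) / real L \<le> angle0 z" "angle0 z < 2 * pi * real k / real L"
      using that by (auto simp: u_def chi_tilde_def split: if_splits)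
    show ?thesis
    proof (cases "j < k")
      case True
      hence "q \<le> 2 * pi * (real k - 1) / real L"
        unfolding q_def by (intro divide_right_mono mult_left_mono) auto
      thus ?thesis using z by auto
    next
      case False
      hence "2 * pi * real k / real L \<le> p"
        unfolding p_def using jk by (intro divide_right_mono mult_left_mono) auto
      thus ?thesis using z by auto
    qed
  qed
  show ?thesis
  proof (rule separated_symbols_low_rank, goal_cases)
    case (1 M)
    note low_rank = 1[OF pq m(1) b(1) _ _ u0]
    show ?thesis
    proof (rule Sigma0_if_low_rank_approximation[OF \<gamma> linear bounded _ refl])
      fix n
      define far where "far w = (if (1 / 2) ^ n \<le> corner_dist p q w then v w else 0)" for w
      define near where "near w = (if (1 / 2) ^ n \<le> corner_dist p q w then 0 else v w)" for w
      have mm: "far \<in> borel_measurable borel" "near \<in> borel_measurable borel"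
        unfolding far_def[abs_def] near_def[abs_def] by measurable
      have bb: "cmod (far z) \<le> 1" "cmod (near z) \<le> 1" for z
        using b by (auto simp: far_def near_def)
      have "low_rank_approximable (M * (n + 1) * (4 * n)) (36 * (8 * real n + 1) / 4 ^ n) (?A far)"
        by (rule low_rank[OF mm(1) bb(1)]) (use v0 in \<open>auto simp: far_def split: if_splits\<close>)
      then obtain r K where r: "r \<le> M * (n + 1) * (4 * n)" and K: "bounded_rank_le r K"
        and K_le: "\<And>f. f \<in> bergman \<Longrightarrow> l2_norm (\<lambda>z. ?A far f z - K f z) \<le> 36 * (8 * real n + 1) / 4 ^ n * l2_norm f"
        unfolding low_rank_approximable_def by blast
      have near_le: "cmod (near z) \<le> (1 + real n * ln 2) powr (- \<gamma>)" if z: "z \<in> disc" for z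
      proof (cases "near z = 0")
        case False
        hence d: "corner_dist p q z < (1 / 2) ^ n" and eq: "near z = v z"
          by (auto simp: near_def split: if_splits)
        \<comment> \<open>Where \<open>near\<close> is nonzero the point lies within 2^-n of a
          corner, hence of the circle, and the logarithm in \<open>phi0\<close> is at least n ln
          2.\<close>
        have "1 - cmod z \<le> (1 / 2) ^ n" using corner_dist_ge[of z p q] d by linarith
        hence "phi0 \<gamma> (cmod z) \<le> (1 + ln (1 / (1 / 2) ^ n)) powr (- \<gamma>)" "0 \<le> phi0 \<gamma> (cmod z)"
          using phi0_le[OF \<gamma>, of "(1 / 2) ^ n" "cmod z"] z by (auto simp: in_disc_iff power_le_one)
        moreover have "ln (1 / (1 / 2) ^ n) = real n * ln (2::real)"
          by (simp add: power_divide ln_realpow)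
        ultimately show ?thesis by (auto simp: eq v_def chi_tilde_def)
      qed simp
      have "l2_norm (\<lambda>z. T f z - K f z) \<le>
          ((1 + real n * ln 2) powr (- \<gamma>) + 36 * (8 * real n + 1) / 4 ^ n) * l2_norm f" if f: "f \<in> bergman" for f
      proof -
        note fL = bergman_L2D[OF f]
        note Lf = wL[OF mm(1) bb(1) fL] and Ln = wL[OF mm(2) bb(2) fL]
        have "(\<lambda>z. v z * f z) = (\<lambda>z. 1 * (far z * f z) + 1 * (near z * f z))"
          by (auto simp: far_def near_def fun_eq_iff)
        hence "bergman_integral (\<lambda>z. v z * f z) = (\<lambda>z. 1 * bergman_integral (\<lambda>z. far z * f z) z + 1 * bergman_integral (\<lambda>z. near z * f z) z)"
          using bergman_integral_lincomb[OF Lf Ln, of 1 1] by simp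
        hence "?A v f = bergman_integral (\<lambda>z. 1 * (u z * bergman_integral (\<lambda>z. far z * f z) z) + 1 * (u z * bergman_integral (\<lambda>z. near z * f z) z))"
          by (simp add: toeplitz_product_def algebra_simps)
        also have "\<dots> = (\<lambda>z. 1 * ?A far f z + 1 * ?A near f z)"
          unfolding toeplitz_product_def
          by (intro bergman_integral_lincomb wL m b bergman_L2D bergman_integral_bergman Lf Ln)
        finally have "(\<lambda>z. T f z - K f z) = (\<lambda>z. ?A near f z + (?A far f z - K f z))"
          by (simp add: TA f fun_eq_iff)
        moreover have "K f \<in> L2D"
          using bounded_rank_le_linear[OF K] f by (auto simp: linear_on_bergman_def bergman_L2D)
        ultimately have "l2_norm (\<lambda>z. T f z - K f z) \<le> l2_norm (?A near f) + l2_norm (\<lambda>z. ?A far f z - K f z)"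
          using l2_norm_triangle[OF bergman_L2D[OF product_bergman[OF mm(2) bb(2) fL]] L2D_diff[OF bergman_L2D[OF product_bergman[OF mm(1) bb(1) fL]]]]
          by simp
        moreover have "l2_norm (?A near f) \<le> (1 + real n * ln 2) powr (- \<gamma>) * l2_norm f"
          by (rule product_le[OF mm(2) bb(2) fL near_le])
        ultimately show ?thesis using K_le[OF f] by (simp add: distrib_right)
      qed
      with r K show "low_rank_approximable (M * (n + 1) * (4 * n))
          ((1 + real n * ln 2) powr (- \<gamma>) + 36 * (8 * real n + 1) / 4 ^ n) T"
        unfolding low_rank_approximable_def by blast
    qed
  qed
qed

theorem theorem3p1:
  fixes \<gamma> :: real and L j k :: nat
  assumes "\<gamma> > 0" and "L \<ge> 1"
    and "j \<in> {1..L}" and "k \<in> {1..L}" and "j \<noteq> k"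
  shows "Sigma0 (2 * \<gamma>) (adjoint_op (toeplitz (chi_tilde \<gamma> L k)) \<circ> toeplitz (chi_tilde \<gamma> L j))
       \<and> Sigma0 (2 * \<gamma>) (toeplitz (chi_tilde \<gamma> L k) \<circ> adjoint_op (toeplitz (chi_tilde \<gamma> L j)))"
proof -
  have adj: "adjoint_op (toeplitz (chi_tilde \<gamma> L i)) g = toeplitz (chi_tilde \<gamma> L i) g" if "g \<in> bergman" for i g
    by (rule adjoint_toeplitz_real[OF that chi_tilde_measurable, where B = 1])
       (auto simp: chi_tilde_bounded[OF assms(1)], simp add: chi_tilde_def)
  \<comment> \<open>In the first product the adjoint is applied to a Toeplitz image, which must lie
    in \<open>bergman\<close> before the adjoint can be replaced by the operator itself.\<close>
  have "toeplitz (chi_tilde \<gamma> L i) f \<in> bergman" if f: "f \<in> bergman" for i f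
    unfolding toeplitz_eq[OF f chi_tilde_measurable chi_tilde_bounded[OF assms(1)]]
    by (intro bergman_integral_bergman L2D_mult_bounded[OF bergman_L2D[OF f] chi_tilde_measurable chi_tilde_bounded[OF assms(1)]])
  thus ?thesis
    using assms by (intro conjI toeplitz_chi_tilde_product_Sigma0) (auto simp: adj)
qed

end
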